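(* Let $n>1$, let $\alpha<0$, and let $\psi:\mathbb{R}^n\to\mathbb{R}$ be a radial window of the form $$\widehat{\overline{\psi}}(\xi)=c_{n,\alpha}\,|\xi|^{\frac12(n-2\alpha)}K_{n/2}(|\xi|),\qquad \xi\in\mathbb{R}^n\setminus\{0\},$$ with a constant $c_{n,\alpha}\ne0$, and let $w(t)=t^{-\beta}$, $t>0$, with $\beta=\frac n2-\alpha$. Then for each cone $C\subset\mathbb{R}^n$ containing the origin with nonempty interior, there is a function $f\in L^2(\mathbb{R}^n)$ such that $\widehat f$ is compactly supported inside $C$ and $$\Delta_h\left(\log|w\cdot W_\psi f|^2\right)(y,t)<0\quad\text{for some }y\in\mathbb{R}^n,\ t>0.$$
   Context: $K_\nu$ denotes the modified Bessel function of the second kind of order $\nu$. The Fourier transform is $\widehat f(\xi)=(2\pi)^{-n/2}\int_{\mathbb{R}^n}f(x)e^{-ix\cdot\xi}\,dx$ (extended to $L^2$). The wavelet transform with window $\psi$ is $$W_\psi f(y,t)=C_\psi\,t^{-n/2}\int_{\mathbb{R}^n}f(x)\,\overline{\psi\left(\frac{x-y}{t}\right)}\,dx,\qquad y\in\mathbb{R}^n,\ t>0,$$ where $C_\psi\neq0$ is a normalizing constant depending only on $\psi$, and $(w\cdot W_\psi f)(y,t)=w(t)W_\psi f(y,t)$. A cone is a subset of $\mathbb{R}^n$ invariant under multiplication by positive scalars. The hyperbolic Laplacian on the upper half-space $\mathbb{R}^{n+1}_+=\{(y,t):y\in\mathbb{R}^n,\ t>0\}$ is $$\Delta_hF(y,t)=t^2\Delta_yF(y,t)+t^2\partial_t^2F(y,t)-(n-1)\,t\,\partial_tF(y,t).$$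 The inequality $\Delta_h(\log|w\cdot W_\psi f|^2)(y,t)<0$ is meant pointwise, at a point where $W_\psi f(y,t)\ne0$. *)

theory Defs
  imports "HOL-Analysis.Analysis"
begin

text \<open>Modified Bessel function of the second kind (Macdonald function) for real order and
  argument \<open>x > 0\<close>, given by its standard integral representation (DLMF 10.32.9), whose
  integrand is absolutely integrable for every \<open>x > 0\<close>.\<close>

definition bessel_K :: "real \<Rightarrow> real \<Rightarrow> real" where
  "bessel_K \<nu> x = (LBINT s:{0..}. exp (- x * cosh s) * cosh (\<nu> * s))"

definition L2_function :: "(real^'n \<Rightarrow> complex) \<Rightarrow> bool" where
  "L2_function f \<longleftrightarrow>
     f \<in> borel_measurable lebesgue \<and> integrable lebesgue (\<lambda>x. (cmod (f x))\<^sup>2)"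

definition fourier_integral :: "(real^'n \<Rightarrow> complex) \<Rightarrow> real^'n \<Rightarrow> complex" where
  "fourier_integral f \<xi> =
     complex_of_real ((2 * pi) powr (- real CARD('n) / 2)) *
     (LINT x|lebesgue. f x * exp (- \<i> * complex_of_real (x \<bullet> \<xi>)))"

text \<open>\<open>g\<close> is (a representative of) the Fourier transform of \<open>f \<in> L\<^sup>2\<close>, i.e. of the value at
  \<open>f\<close> of the continuous extension of \<^const>\<open>fourier_integral\<close> from \<open>L\<^sup>1 \<inter> L\<^sup>2\<close> to \<open>L\<^sup>2\<close>.
  By Plancherel's theorem \<open>g\<close> exists and is unique up to null sets. The \<open>L\<^sup>2\<close>
  distances are measured with the nonnegative integral, so that an infinite distance is not
  silently read as \<open>0\<close>.\<close>

definition is_fourier_L2 :: "(real^'n \<Rightarrow> complex) \<Rightarrow> (real^'n \<Rightarrow> complex) \<Rightarrow> bool" where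
  "is_fourier_L2 f g \<longleftrightarrow>
     L2_function f \<and> L2_function g \<and>
     (\<exists>h :: nat \<Rightarrow> real^'n \<Rightarrow> complex.
        (\<forall>k. integrable lebesgue (h k) \<and> L2_function (h k)) \<and>
        (\<lambda>k. \<integral>\<^sup>+x. ennreal ((cmod (h k x - f x))\<^sup>2) \<partial>lebesgue) \<longlonglongrightarrow> 0 \<and>
        (\<lambda>k. \<integral>\<^sup>+\<xi>. ennreal ((cmod (fourier_integral (h k) \<xi> - g \<xi>))\<^sup>2) \<partial>lebesgue)
          \<longlonglongrightarrow> 0)"

text \<open>The first argument is the normalizing constant.\<close>

definition wavelet_transform ::
    "complex \<Rightarrow> (real^'n \<Rightarrow> complex) \<Rightarrow> (real^'n \<Rightarrow> complex) \<Rightarrow> real^'n \<Rightarrow> real \<Rightarrow> complex" where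
  "wavelet_transform A \<psi> f y t =
     A * complex_of_real (t powr (- real CARD('n) / 2)) *
     (LINT x|lebesgue. f x * cnj (\<psi> ((x - y) /\<^sub>R t)))"

definition hyp_laplacian :: "(real^'n \<Rightarrow> real \<Rightarrow> real) \<Rightarrow> real^'n \<Rightarrow> real \<Rightarrow> real" where
  "hyp_laplacian F y t =
     t\<^sup>2 * (\<Sum>i\<in>UNIV. (deriv ^^ 2) (\<lambda>s. F (y + s *\<^sub>R axis i 1) t) 0)
     + t\<^sup>2 * (deriv ^^ 2) (\<lambda>s. F y s) t
     - (real CARD('n) - 1) * t * deriv (\<lambda>s. F y s) t"

end

theory Submission
  imports Defs "HOL-Probability.Probability"
begin

text \<open>Choose \<open>p \<noteq> 0\<close> in the interior of the cone and a unit vector \<open>e\<close> orthogonal to \<open>p\<close>, and let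
  \<open>g \<xi> = (\<xi> \<bullet> e) max(0, \<epsilon> - |\<xi> - p|)\<close> be the Fourier transform of \<open>f\<close>. By Parseval, up to a nonzero
  constant, \<open>w \<cdot> W f\<close> is
  \<open>u(y,t) = t\<^bsup>n/2\<^esup> \<integral> g(\<xi>) |\<xi>|\<^bsup>\<beta>\<^esup> K(t|\<xi>|) exp(i y\<bullet>\<xi>) d\<xi>\<close>. As \<open>g\<close> is odd under the reflection in the
  hyperplane orthogonal to \<open>e\<close>, both \<open>u\<close> and \<open>\<partial>\<^sub>t u\<close> vanish at \<open>(0,1)\<close>, while the gradient in \<open>y\<close> is
  \<open>i m\<close> with a real vector \<open>m\<close> such that \<open>m \<bullet> e > 0\<close>. Since \<open>\<Delta> log |u|\<^sup>2 = 2 Re (\<Delta>u / u - (\<nabla>u \<bullet> \<nabla>u) / u\<^sup>2)\<close>, the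
  hyperbolic Laplacian at \<open>(s e, 1)\<close> behaves like \<open>- 2 |m|\<^sup>2 / (s m\<bullet>e)\<^sup>2\<close> as \<open>s\<close> tends to \<open>0\<close> from the right. Only the
  smoothness of \<open>u\<close> matters here, not the Bessel equation.\<close>

subsection \<open>Lebesgue measure and differentiation under the integral\<close>

text \<open>The sign rests on \<open>g\<close> being real. At \<open>y = 0\<close> the
  \<open>t\<close>-derivative of \<open>u\<close> is then a real multiple, and the gradient in
  \<open>y\<close> an imaginary multiple, of the same constant, so their squares enter the sum of
  squares of first derivatives with opposite signs. They can cancel: for n = 1 and a half-line,
  t^(1/2) K_(1/2)(t |\<xi>|) is a multiple of |\<xi>|^(-1/2) exp(-t |\<xi>|), so \<open>u\<close> is
  holomorphic in y + i t and log |u|^2 is harmonic off the zeros. The reflection removes the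
  \<open>t\<close>-derivative and keeps the gradient. It must fix \<open>p\<close>, so that the bump
  stays in the cone, and this is where a second dimension enters. A tent is smooth enough for
  \<open>g\<close>: as its support is compact and avoids 0, \<open>u\<close> can be differentiated
  under the integral, although K is singular at 0. The transforms of \<open>f\<close> and of the
  window are given only through approximating sequences. Everything is therefore derived from
  Parseval for two integrable functions, which is Fubini: \<open>f\<close> is damped by wide
  Gaussians, and the window is replaced by its approximants.\<close>

lemma sigma_finite_lebesgue: "sigma_finite_measure (lebesgue :: 'a::euclidean_space measure)"
proof
  obtain A :: "nat \<Rightarrow> 'a set" where A: "range A \<subseteq> sets lborel" "\<Union>(range A) = space lborel"
      "\<And>i. emeasure lborel (A i) \<noteq> \<infinity>"
    using lborel.sigma_finite by metis
  have "countable (range A)" "range A \<subseteq> sets lebesgue" "\<Union>(range A) = space lebesgue"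
    "\<forall>a\<in>range A. emeasure lebesgue a \<noteq> \<infinity>"
    using A by (auto simp: emeasure_completion image_subset_iff)
  then show "\<exists>A :: 'a set set. countable A \<and> A \<subseteq> sets lebesgue \<and> \<Union> A = space lebesgue \<and>
      (\<forall>a\<in>A. emeasure lebesgue a \<noteq> \<infinity>)" by blast
qed

interpretation lebesgue: sigma_finite_measure lebesgue
  by (rule sigma_finite_lebesgue)

text \<open>The transforms are integrals over the completed measure, so Fubini is applied to the
  product of two copies of \<open>lebesgue\<close>.\<close>

interpretation lebesgue_pair: pair_sigma_finite lebesgue lebesgue ..

text \<open>Stated as an identity of measures, so that the substitution rules for nonnegative and
  for Bochner integrals both follow from it.\<close>

lemma
  fixes y :: "'a::euclidean_space"
  assumes "t > 0"
  shows measurable_lebesgue_shift_scale: "(\<lambda>x. (x - y) /\<^sub>R t) \<in> lebesgue \<rightarrow>\<^sub>M lebesgue" (is ?M)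
    and lebesgue_shift_scale: "lebesgue = density (distr lebesgue lebesgue (\<lambda>x. (x - y) /\<^sub>R t))
      (\<lambda>_. ennreal ((1 / t) ^ DIM('a)))" (is ?D)
proof -
  have eq: "- y /\<^sub>R t + (\<Sum>j\<in>Basis. ((1 / t) * (x \<bullet> j)) *\<^sub>R j) = (x - y) /\<^sub>R t" for x
    unfolding scaleR_scaleR[symmetric] scaleR_sum_right[symmetric] euclidean_representation
    by (simp add: algebra_simps divide_inverse)
  have ne: "1 / t \<noteq> 0" using assms by simp
  show ?M ?D
    using lebesgue_affine_measurable[of "\<lambda>_. 1 / t" "- y /\<^sub>R t"] lebesgue_affine_euclidean[of "\<lambda>_. 1 / t" "- y /\<^sub>R t"]
      assms unfolding eq prod_constant by simp_all
qed

lemma nn_integral_shift_scale: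
  fixes F :: "'a::euclidean_space \<Rightarrow> ennreal"
  assumes "t > 0" and [measurable]: "F \<in> borel_measurable lebesgue"
  shows "(\<integral>\<^sup>+x. F ((x - y) /\<^sub>R t) \<partial>lebesgue) = ennreal (t ^ DIM('a)) * (\<integral>\<^sup>+x. F x \<partial>lebesgue)"
proof -
  note [measurable] = measurable_lebesgue_shift_scale[OF assms(1), of y]
  have "(\<integral>\<^sup>+x. F x \<partial>lebesgue) = (\<integral>\<^sup>+x. F x \<partial>density (distr lebesgue lebesgue (\<lambda>x. (x - y) /\<^sub>R t))
      (\<lambda>_. ennreal ((1 / t) ^ DIM('a))))"
    using lebesgue_shift_scale[OF assms(1), of y] by metis
  also have "\<dots> = ennreal ((1 / t) ^ DIM('a)) * (\<integral>\<^sup>+x. F ((x - y) /\<^sub>R t) \<partial>lebesgue)"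
    by (simp add: nn_integral_density nn_integral_distr nn_integral_cmult)
  finally show ?thesis
    using assms(1) by (simp add: mult.assoc[symmetric] ennreal_mult[symmetric] power_one_over power_mult_distrib[symmetric])
qed

lemma
  fixes F :: "'a::euclidean_space \<Rightarrow> 'b::{banach, second_countable_topology}"
  assumes "t > 0" and F: "integrable lebesgue F"
  shows integrable_shift_scale: "integrable lebesgue (\<lambda>x. F ((x - y) /\<^sub>R t))" (is ?I)
    and integral_shift_scale: "(LINT x|lebesgue. F ((x - y) /\<^sub>R t)) = t ^ DIM('a) *\<^sub>R (LINT x|lebesgue. F x)" (is ?E)
proof -
  note [measurable] = measurable_lebesgue_shift_scale[OF assms(1), of y]
  have [measurable]: "F \<in> borel_measurable lebesgue" using F by simp
  have *: "integrable (density (distr lebesgue lebesgue (\<lambda>x. (x - y) /\<^sub>R t))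
      (\<lambda>_. ennreal ((1 / t) ^ DIM('a)))) F"
    using lebesgue_shift_scale[OF assms(1), of y] F by metis
  then have "integrable lebesgue (\<lambda>x. (1 / t) ^ DIM('a) *\<^sub>R F ((x - y) /\<^sub>R t))"
    using assms(1) by (simp add: integrable_density integrable_distr_eq)
  from integrable_scaleR_right[OF this, of "t ^ DIM('a)"] show ?I
    using assms(1) by (simp add: power_one_over)
  have "(LINT x|lebesgue. F x) = integral\<^sup>L (density (distr lebesgue lebesgue (\<lambda>x. (x - y) /\<^sub>R t))
      (\<lambda>_. ennreal ((1 / t) ^ DIM('a)))) F"
    using lebesgue_shift_scale[OF assms(1), of y] by metis
  also have "\<dots> = (1 / t) ^ DIM('a) *\<^sub>R (LINT x|lebesgue. F ((x - y) /\<^sub>R t))"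
    using assms(1) by (simp add: integral_density integral_distr)
  finally show ?E
    using assms(1) by (simp add: power_one_over power_mult_distrib[symmetric])
qed

lemma norm_diff_le_vector_derivative_bound:
  fixes f :: "real \<Rightarrow> 'b::real_normed_vector"
  assumes "convex S" "\<And>s. s \<in> S \<Longrightarrow> (f has_vector_derivative f' s) (at s)"
    "\<And>s. s \<in> S \<Longrightarrow> norm (f' s) \<le> B" "x \<in> S" "y \<in> S"
  shows "norm (f x - f y) \<le> B * \<bar>x - y\<bar>"
proof -
  have "norm (f x - f y) \<le> B * norm (x - y)"
  proof (rule differentiable_bound[OF assms(1)])
    show "(f has_derivative (\<lambda>h. h *\<^sub>R f' s)) (at s within S)" if "s \<in> S" for s
      using assms(2)[OF that] unfolding has_vector_derivative_def by (rule has_derivative_at_withinI)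
    show "onorm (\<lambda>h. h *\<^sub>R f' s) \<le> B" if "s \<in> S" for s
    proof (rule onorm_bound)
      show "0 \<le> B" using assms(3)[OF that] norm_ge_zero order_trans by blast
      show "norm (h *\<^sub>R f' s) \<le> B * norm h" for h
        using mult_right_mono[OF assms(3)[OF that], of "\<bar>h\<bar>"] by (simp add: mult.commute)
    qed
  qed (use assms in auto)
  then show ?thesis by simp
qed

lemma has_vector_derivative_iff_quotient:
  fixes f :: "real \<Rightarrow> 'b::real_normed_vector"
  shows "(f has_vector_derivative D) (at t) \<longleftrightarrow> ((\<lambda>s. (f s - f t) /\<^sub>R (s - t)) \<longlongrightarrow> D) (at t)"
proof -
  have eq: "norm (f s - f t - (s - t) *\<^sub>R D) / norm (s - t) = norm ((f s - f t) /\<^sub>R (s - t) - D)" if "s \<noteq> t" for s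
  proof -
    have "(f s - f t) /\<^sub>R (s - t) - D = (f s - f t - (s - t) *\<^sub>R D) /\<^sub>R (s - t)"
      using that by (simp add: scaleR_diff_right)
    then show ?thesis by (simp add: divide_inverse mult.commute)
  qed
  have "(f has_vector_derivative D) (at t) \<longleftrightarrow>
      ((\<lambda>s. norm (f s - f t - (s - t) *\<^sub>R D) / norm (s - t)) \<longlongrightarrow> 0) (at t)"
    unfolding has_vector_derivative_def has_derivative_iff_norm by (simp add: bounded_linear_scaleR_left)
  also have "\<dots> \<longleftrightarrow> ((\<lambda>s. norm ((f s - f t) /\<^sub>R (s - t) - D)) \<longlongrightarrow> 0) (at t)"
    by (rule tendsto_cong) (use eq in \<open>auto simp: eventually_at_filter\<close>)
  finally show ?thesis by (simp add: tendsto_norm_zero_iff Lim_null[symmetric])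
qed

text \<open>Dominated convergence for difference quotients: the mean value inequality bounds each
  quotient by \<open>G\<close>. Limits are taken along sequences, where the convergence theorem
  applies.\<close>

lemma has_vector_derivative_lebesgue_integral:
  fixes f f' :: "real \<Rightarrow> 'a \<Rightarrow> 'b::euclidean_space"
  assumes "\<delta> > 0" and int: "\<And>s. s \<in> ball t \<delta> \<Longrightarrow> integrable M (f s)"
    and der: "\<And>s x. s \<in> ball t \<delta> \<Longrightarrow> x \<in> space M \<Longrightarrow> ((\<lambda>s. f s x) has_vector_derivative f' s x) (at s)"
    and bound: "\<And>s x. s \<in> ball t \<delta> \<Longrightarrow> x \<in> space M \<Longrightarrow> norm (f' s x) \<le> G x" and G: "integrable M G"
  shows "((\<lambda>s. LINT x|M. f s x) has_vector_derivative (LINT x|M. f' t x)) (at t)"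
    and "integrable M (f' t)"
proof -
  have t: "t \<in> ball t \<delta>" using assms(1) by simp
  define q where "q s x = (f s x - f t x) /\<^sub>R (s - t)" for s x
  have q: "((\<lambda>s. q s x) \<longlongrightarrow> f' t x) (at t within ball t \<delta>)" if "x \<in> space M" for x
    using der[OF t that] assms(1) unfolding q_def has_vector_derivative_iff_quotient by (simp add: at_within_ball)
  have main: "integrable M (f' t) \<and> (\<lambda>n. LINT x|M. q (X n) x) \<longlonglongrightarrow> (LINT x|M. f' t x)"
    if X: "\<And>i. X i \<in> ball t \<delta> - {t}" "X \<longlonglongrightarrow> t" for X
  proof -
    have lim: "(\<lambda>n. q (X n) x) \<longlonglongrightarrow> f' t x" if "x \<in> space M" for x
      using q[OF that] X unfolding tendsto_at_iff_sequentially comp_def by blast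
    have m[measurable]: "(\<lambda>x. q (X n) x) \<in> borel_measurable M" for n
      using borel_measurable_integrable[OF int[OF t]] borel_measurable_integrable[OF int[of "X n"]] X(1)[of n]
      unfolding q_def by simp
    \<comment> \<open>Measurability of the derivative is inherited from the difference quotients,
      whose pointwise limit it is.\<close>
    have m2[measurable]: "f' t \<in> borel_measurable M"
      by (rule borel_measurable_LIMSEQ_metric[of "\<lambda>n x. q (X n) x"]) (use lim in auto)
    have b: "norm (q (X n) x) \<le> G x" if "x \<in> space M" for n x
    proof -
      have "norm (f (X n) x - f t x) \<le> G x * \<bar>X n - t\<bar>"
        by (rule norm_diff_le_vector_derivative_bound[OF convex_ball[of t \<delta>] der[OF _ that] bound[OF _ that]])
          (use X(1)[of n] t in auto)
      moreover have "\<bar>X n - t\<bar> > 0" using X(1)[of n] by simp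
      ultimately show ?thesis
        by (simp only: q_def norm_scaleR abs_inverse) (simp add: field_simps)
    qed
    show ?thesis
      by (intro conjI integrable_dominated_convergence[of "f' t" M "\<lambda>n. q (X n)" G]
          integral_dominated_convergence[of "f' t" M "\<lambda>n. q (X n)" G])
        (use lim b G in auto)
  qed
  \<comment> \<open>Integrability of \<open>f' t\<close> only requires one sequence in the punctured
    ball that tends to \<open>t\<close>.\<close>
  have "(\<lambda>n. t + (\<delta> / 2) * inverse (real (Suc n))) \<longlonglongrightarrow> t + (\<delta> / 2) * 0"
    by (intro tendsto_intros LIMSEQ_inverse_real_of_nat)
  then have X: "(\<lambda>n. t + (\<delta> / 2) * inverse (real (Suc n))) \<longlonglongrightarrow> t" by simp
  have "\<delta> / 2 * inverse (real (Suc n)) < \<delta>" for n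
    using assms(1) by (simp add: field_simps add_pos_nonneg)
  then show "integrable M (f' t)"
    using main[OF _ X] assms(1) by (auto simp: dist_real_def)
  have eq: "(LINT x|M. q s x) = ((LINT x|M. f s x) - (LINT x|M. f t x)) /\<^sub>R (s - t)" if "s \<in> ball t \<delta>" for s
    unfolding q_def using int[OF that] int[OF t] by simp
  have "((\<lambda>s. LINT x|M. q s x) \<longlongrightarrow> (LINT x|M. f' t x)) (at t within ball t \<delta>)"
    unfolding tendsto_at_iff_sequentially comp_def using main by blast
  moreover have "\<forall>\<^sub>F s in at t. (LINT x|M. q s x) = ((LINT x|M. f s x) - (LINT x|M. f t x)) /\<^sub>R (s - t)"
    unfolding eventually_at using eq assms(1) by (auto simp: dist_commute)
  ultimately show "((\<lambda>s. LINT x|M. f s x) has_vector_derivative (LINT x|M. f' t x)) (at t)"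
    using assms(1) unfolding has_vector_derivative_iff_quotient
    by (simp add: at_within_ball tendsto_cong)
qed

subsection \<open>Odd functions under a reflection\<close>

text \<open>Translation invariance and Fubini suffice, without determinants: pair the set with a
  ball, which the isometry preserves, and compute the resulting double integral in both
  orders.\<close>

lemma lborel_distr_isometric_involution:
  fixes \<sigma> :: "'a::euclidean_space \<Rightarrow> 'a"
  assumes lin: "linear \<sigma>" and inv: "\<And>x. \<sigma> (\<sigma> x) = x" and iso: "\<And>x. norm (\<sigma> x) = norm x"
  shows "distr lborel borel \<sigma> = lborel"
proof (rule measure_eqI)
  fix A :: "'a set" assume "A \<in> sets (distr lborel borel \<sigma>)"
  then have [measurable]: "A \<in> sets borel" by simp
  have [measurable]: "\<sigma> \<in> borel_measurable borel"
    using lin by (intro borel_measurable_continuous_onI linear_continuous_on linear_conv_bounded_linear[THEN iffD1])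
  have shift: "(\<integral>\<^sup>+x. h x \<partial>lborel) = (\<integral>\<^sup>+x. h (a + x) \<partial>lborel)"
    if [measurable]: "h \<in> borel_measurable borel" for h :: "'a \<Rightarrow> ennreal" and a
  proof -
    have "(\<integral>\<^sup>+x. h x \<partial>lborel) = (\<integral>\<^sup>+x. h x \<partial>distr lborel borel ((+) a))"
      by (simp add: lborel_distr_plus)
    also have "\<dots> = (\<integral>\<^sup>+x. h (a + x) \<partial>lborel)"
      by (subst nn_integral_distr) auto
    finally show ?thesis .
  qed
  \<comment> \<open>The test weight \<open>b\<close> is invariant under \<open>- \<sigma>\<close>
    and has finite nonzero integral, so it can be cancelled at the end.\<close>
  define h b :: "'a \<Rightarrow> ennreal" where "h = indicator A" and "b = indicator (ball 0 1)"
  have [measurable]: "h \<in> borel_measurable borel" "b \<in> borel_measurable borel"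
    unfolding h_def b_def by (auto intro!: borel_measurable_indicator)
  have b: "b (- \<sigma> x) = b x" for x by (simp add: b_def iso indicator_def)
  have "(\<integral>\<^sup>+y. h (\<sigma> y) \<partial>lborel) * (\<integral>\<^sup>+x. b x \<partial>lborel) = (\<integral>\<^sup>+y. h (\<sigma> y) * (\<integral>\<^sup>+x. b x \<partial>lborel) \<partial>lborel)"
    by (simp add: nn_integral_multc)
  also have "\<dots> = (\<integral>\<^sup>+y. (\<integral>\<^sup>+x. h (\<sigma> y) * b (x - \<sigma> y) \<partial>lborel) \<partial>lborel)"
  proof (rule nn_integral_cong)
    fix y
    have "(\<integral>\<^sup>+x. b x \<partial>lborel) = (\<integral>\<^sup>+x. b (- \<sigma> y + x) \<partial>lborel)" by (rule shift) measurable
    then show "h (\<sigma> y) * (\<integral>\<^sup>+x. b x \<partial>lborel) = (\<integral>\<^sup>+x. h (\<sigma> y) * b (x - \<sigma> y) \<partial>lborel)"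
      by (simp add: nn_integral_cmult)
  qed
  also have "\<dots> = (\<integral>\<^sup>+x. (\<integral>\<^sup>+y. h (\<sigma> y) * b (x - \<sigma> y) \<partial>lborel) \<partial>lborel)"
    by (rule lborel_pair.Fubini') measurable
  also have "\<dots> = (\<integral>\<^sup>+x. (\<integral>\<^sup>+y. h (x + \<sigma> y) * b (- \<sigma> y) \<partial>lborel) \<partial>lborel)"
  proof (rule nn_integral_cong)
    fix x
    have "(\<integral>\<^sup>+y. h (\<sigma> y) * b (x - \<sigma> y) \<partial>lborel) = (\<integral>\<^sup>+y. h (\<sigma> (\<sigma> x + y)) * b (x - \<sigma> (\<sigma> x + y)) \<partial>lborel)"
      by (rule shift) measurable
    then show "(\<integral>\<^sup>+y. h (\<sigma> y) * b (x - \<sigma> y) \<partial>lborel) = (\<integral>\<^sup>+y. h (x + \<sigma> y) * b (- \<sigma> y) \<partial>lborel)"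
      by (simp add: linear_add[OF lin] inv)
  qed
  also have "\<dots> = (\<integral>\<^sup>+y. (\<integral>\<^sup>+x. h (x + \<sigma> y) * b (- \<sigma> y) \<partial>lborel) \<partial>lborel)"
    by (rule lborel_pair.Fubini') measurable
  also have "\<dots> = (\<integral>\<^sup>+y. (\<integral>\<^sup>+x. h x \<partial>lborel) * b y \<partial>lborel)"
  proof (rule nn_integral_cong)
    fix y
    have "(\<integral>\<^sup>+x. h x \<partial>lborel) = (\<integral>\<^sup>+x. h (\<sigma> y + x) \<partial>lborel)" by (rule shift) measurable
    then show "(\<integral>\<^sup>+x. h (x + \<sigma> y) * b (- \<sigma> y) \<partial>lborel) = (\<integral>\<^sup>+x. h x \<partial>lborel) * b y"
      by (simp add: nn_integral_multc b add.commute)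
  qed
  also have "\<dots> = (\<integral>\<^sup>+x. h x \<partial>lborel) * (\<integral>\<^sup>+x. b x \<partial>lborel)"
    by (simp add: nn_integral_cmult)
  finally have *: "(\<integral>\<^sup>+y. h (\<sigma> y) \<partial>lborel) * (\<integral>\<^sup>+x. b x \<partial>lborel) = (\<integral>\<^sup>+x. h x \<partial>lborel) * (\<integral>\<^sup>+x. b x \<partial>lborel)" .
  have B: "(\<integral>\<^sup>+x. b x \<partial>lborel) = emeasure lborel (ball (0::'a) 1)"
    by (simp add: b_def)
  have "(\<integral>\<^sup>+x. b x \<partial>lborel) \<noteq> 0"
    unfolding B using open_not_negligible[of "ball (0::'a) 1"]
    by (auto simp: negligible_iff_null_sets null_sets_def)
  moreover have "(\<integral>\<^sup>+x. b x \<partial>lborel) \<noteq> \<top>"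
    unfolding B using emeasure_bounded_finite[of "ball (0::'a) 1"] by simp
  ultimately have "(\<integral>\<^sup>+y. h (\<sigma> y) \<partial>lborel) = (\<integral>\<^sup>+x. h x \<partial>lborel)"
    using * by (metis ennreal_mult_cancel_left mult.commute)
  moreover have "(\<integral>\<^sup>+y. h (\<sigma> y) \<partial>lborel) = emeasure (distr lborel borel \<sigma>) A"
    by (subst nn_integral_distr[of \<sigma> lborel borel h, symmetric]) (simp_all add: h_def)
  ultimately show "emeasure (distr lborel borel \<sigma>) A = emeasure lborel A"
    by (simp add: h_def)
qed simp

text \<open>The substitution \<open>\<sigma>\<close> turns the integral into its own negative. A
  non-integrable \<open>F\<close> has integral 0 by convention, which is consistent with
  this.\<close>

lemma integral_odd_eq_0:
  fixes F :: "'a::euclidean_space \<Rightarrow> complex"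
  assumes "linear \<sigma>" "\<And>x. \<sigma> (\<sigma> x) = x" "\<And>x. norm (\<sigma> x) = norm x"
    and [measurable]: "F \<in> borel_measurable borel" and odd: "\<And>x. F (\<sigma> x) = - F x"
  shows "(LINT x|lebesgue. F x) = 0"
proof -
  have [measurable]: "\<sigma> \<in> borel_measurable borel"
    using assms(1) by (intro borel_measurable_continuous_onI linear_continuous_on linear_conv_bounded_linear[THEN iffD1])
  have "(LINT x|lborel. F x) = (LINT x|distr lborel borel \<sigma>. F x)"
    using lborel_distr_isometric_involution[OF assms(1-3)] by simp
  also have "\<dots> = - (LINT x|lborel. F x)"
    by (subst integral_distr) (simp_all add: odd)
  finally show ?thesis by (simp add: integral_completion)
qed

lemma linear_reflection: "linear (\<lambda>x::'a::euclidean_space. x - (2 * (x \<bullet> e)) *\<^sub>R e)"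
  by (intro linearI) (auto simp: algebra_simps)

lemma reflection_inner:
  assumes "norm e = 1" shows "(x - (2 * (x \<bullet> e)) *\<^sub>R e) \<bullet> e = - (x \<bullet> e)"
  using assms by (simp add: inner_diff_left norm_eq_1)

lemma reflection_reflection:
  assumes "norm e = 1"
  shows "(x - (2 * (x \<bullet> e)) *\<^sub>R e) - (2 * ((x - (2 * (x \<bullet> e)) *\<^sub>R e) \<bullet> e)) *\<^sub>R e = x"
  unfolding reflection_inner[OF assms] by simp

lemma norm_reflection:
  assumes "norm e = 1" shows "norm (x - (2 * (x \<bullet> e)) *\<^sub>R e) = norm x"
  using assms unfolding norm_eq by (simp add: norm_eq_1 algebra_simps inner_commute)

subsection \<open>The Gaussian\<close>

lemma has_bochner_integral_lborel_prod:
  fixes f :: "'a::euclidean_space \<Rightarrow> real \<Rightarrow> complex"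
  assumes f: "\<And>b. b \<in> Basis \<Longrightarrow> integrable lborel (f b)"
  shows "has_bochner_integral lborel (\<lambda>x. \<Prod>b\<in>Basis. f b (x \<bullet> b)) (\<Prod>b\<in>Basis. (LINT x|lborel. f b x))"
proof -
  interpret product_sigma_finite "\<lambda>_::'a. lborel :: real measure" ..
  let ?P = "\<Pi>\<^sub>M b\<in>(Basis::'a set). lborel :: real measure"
  have [measurable]: "f b \<in> borel_measurable borel" if "b \<in> Basis" for b
    using borel_measurable_integrable[OF f[OF that]] by simp
  have T[measurable]: "(\<lambda>f. \<Sum>b\<in>Basis. f b *\<^sub>R b) \<in> ?P \<rightarrow>\<^sub>M borel"
    by measurable
  have m: "(\<lambda>x::'a. \<Prod>b\<in>Basis. f b (x \<bullet> b)) \<in> borel_measurable borel"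
    by measurable
  have eq: "(\<Prod>b\<in>Basis. f b ((\<Sum>b\<in>Basis. g b *\<^sub>R b) \<bullet> b)) = (\<Prod>b\<in>Basis. f b (g b))" for g :: "'a \<Rightarrow> real"
    by (intro prod.cong) auto
  have "integrable ?P (\<lambda>g. \<Prod>b\<in>Basis. f b (g b))"
    by (rule product_integrable_prod) (use f in auto)
  moreover have "(LINT g|?P. (\<Prod>b\<in>Basis. f b (g b))) = (\<Prod>b\<in>Basis. (LINT x|lborel. f b x))"
    by (rule product_integral_prod) (use f in auto)
  ultimately show ?thesis
    unfolding has_bochner_integral_iff
    by (subst (1 2) lborel_eq) (simp add: integrable_distr_eq[OF T m] integral_distr[OF T m] eq)
qed

text \<open>This is the characteristic function of the standard normal distribution, with the
  density's factor 1 / sqrt(2 pi) moved to the other side.\<close>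

lemma has_bochner_integral_gaussian_iexp_real:
  "has_bochner_integral lborel (\<lambda>x. complex_of_real (exp (- x\<^sup>2 / 2)) * iexp (t * x))
     (complex_of_real (sqrt (2 * pi) * exp (- t\<^sup>2 / 2)))"
proof -
  have i: "integrable lborel (\<lambda>x. std_normal_density x *\<^sub>R iexp (t * x))"
    by (rule Bochner_Integration.integrable_bound[OF integrable_normal_moment[of 1 0 0]])
       (auto simp: normal_density_nonneg)
  have "(LINT x|lborel. std_normal_density x *\<^sub>R iexp (t * x)) = char std_normal_distribution t"
    unfolding char_def by (subst integral_density) (auto simp: normal_density_nonneg)
  then have "has_bochner_integral lborel (\<lambda>x. std_normal_density x *\<^sub>R iexp (t * x)) (complex_of_real (exp (- t\<^sup>2 / 2)))"
    using i by (simp add: char_std_normal_distribution has_bochner_integral_iff)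
  from has_bochner_integral_scaleR_right[OF this, of "sqrt (2 * pi)"]
  show ?thesis
    by (simp add: std_normal_density_def scaleR_conv_of_real mult.assoc)
qed

lemma gaussian_eq_prod: "exp (- (norm x)\<^sup>2 / 2) = (\<Prod>b\<in>Basis. exp (- (x \<bullet> b)\<^sup>2 / 2))" for x :: "'a::euclidean_space"
proof -
  have "(norm x)\<^sup>2 = (\<Sum>b\<in>Basis. (x \<bullet> b)\<^sup>2)"
    unfolding power2_norm_eq_inner by (subst euclidean_inner) (simp add: power2_eq_square)
  then show ?thesis
    by (simp add: exp_sum[symmetric] sum_negf sum_divide_distrib)
qed

lemma has_bochner_integral_gaussian_iexp:
  fixes \<zeta> :: "'a::euclidean_space"
  shows "has_bochner_integral lebesgue (\<lambda>x. complex_of_real (exp (- (norm x)\<^sup>2 / 2)) * iexp (\<zeta> \<bullet> x))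
     (complex_of_real ((2 * pi) powr (real DIM('a) / 2) * exp (- (norm \<zeta>)\<^sup>2 / 2)))"
proof -
  have 1: "has_bochner_integral lborel
      (\<lambda>x::'a. \<Prod>b\<in>Basis. complex_of_real (exp (- (x \<bullet> b)\<^sup>2 / 2)) * iexp ((\<zeta> \<bullet> b) * (x \<bullet> b)))
      (\<Prod>b\<in>Basis. (LINT x|lborel. complex_of_real (exp (- x\<^sup>2 / 2)) * iexp ((\<zeta> \<bullet> b) * x)))"
    by (rule has_bochner_integral_lborel_prod) 
      (use has_bochner_integral_gaussian_iexp_real in \<open>auto simp: has_bochner_integral_iff\<close>)
  have 2: "iexp (\<zeta> \<bullet> x) = (\<Prod>b\<in>Basis. iexp ((\<zeta> \<bullet> b) * (x \<bullet> b)))" for x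
    by (subst euclidean_inner) (simp add: exp_sum[symmetric] sum_distrib_left)
  have 3: "(LINT x|lborel. complex_of_real (exp (- x\<^sup>2 / 2)) * iexp (s * x))
      = complex_of_real (sqrt (2 * pi) * exp (- s\<^sup>2 / 2))" for s
    using has_bochner_integral_gaussian_iexp_real[of s] by (simp add: has_bochner_integral_iff)
  have 4: "sqrt (2 * pi) ^ DIM('a) = (2 * pi) powr (real DIM('a) / 2)"
    by (simp add: powr_half_sqrt[symmetric] powr_powr powr_realpow[symmetric])
  have "has_bochner_integral lborel (\<lambda>x::'a. complex_of_real (exp (- (norm x)\<^sup>2 / 2)) * iexp (\<zeta> \<bullet> x))
     (complex_of_real ((2 * pi) powr (real DIM('a) / 2) * exp (- (norm \<zeta>)\<^sup>2 / 2)))"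
  proof -
    have "(\<Prod>b\<in>Basis. complex_of_real (exp (- (x \<bullet> b)\<^sup>2 / 2)) * iexp ((\<zeta> \<bullet> b) * (x \<bullet> b)))
        = complex_of_real (exp (- (norm x)\<^sup>2 / 2)) * iexp (\<zeta> \<bullet> x)" for x
      unfolding 2 gaussian_eq_prod[of x] prod.distrib of_real_prod ..
    moreover have "(\<Prod>b\<in>Basis. (LINT x|lborel. complex_of_real (exp (- x\<^sup>2 / 2)) * iexp ((\<zeta> \<bullet> b) * x)))
        = complex_of_real ((2 * pi) powr (real DIM('a) / 2) * exp (- (norm \<zeta>)\<^sup>2 / 2))"
      unfolding 3 gaussian_eq_prod[of \<zeta>] of_real_prod[symmetric] prod.distrib prod_constant 4 ..
    ultimately show ?thesis using 1 by presburger
  qed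
  then show ?thesis
    by (simp add: has_bochner_integral_iff integrable_completion integral_completion)
qed

lemma integrable_gaussian:
  assumes "a > 0"
  shows "integrable lebesgue (\<lambda>x::'a::euclidean_space. exp (- a * (norm x)\<^sup>2))"
proof -
  have "integrable lebesgue (\<lambda>x::'a. complex_of_real (exp (- (norm x)\<^sup>2 / 2)))"
    using has_bochner_integral_gaussian_iexp[of "0::'a"] by (simp add: has_bochner_integral_iff)
  then have "integrable lebesgue (\<lambda>x::'a. exp (- (norm x)\<^sup>2 / 2))"
    using complex_of_real_integrable_eq by blast
  from integrable_shift_scale[OF _ this, of "1 / sqrt (2 * a)" 0] show ?thesis
    using assms by (simp add: power_mult_distrib mult.commute)
qed

lemma fourier_integral_gaussian_mass:
  "complex_of_real ((2 * pi) powr (- real CARD('n) / 2)) *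
     (LINT x|lebesgue. complex_of_real (exp (- (norm (x :: real^'n))\<^sup>2 / 2))) = 1"
  using has_bochner_integral_gaussian_iexp[of "0 :: real^'n"]
  by (simp add: has_bochner_integral_iff powr_minus)

subsection \<open>The Fourier transform on integrable and square-integrable functions\<close>

text \<open>Continuity gives Borel measurability; the completed factors are reached through the
  identity map from \<open>lebesgue\<close> to \<open>borel\<close>.\<close>

lemma borel_measurable_lebesgue_inner:
  "(\<lambda>p :: 'a::euclidean_space \<times> 'a. fst p \<bullet> snd p) \<in> borel_measurable (lebesgue \<Otimes>\<^sub>M lebesgue)"
proof -
  have *: "(\<lambda>x. x) \<in> lebesgue \<rightarrow>\<^sub>M (borel :: 'a measure)" by (rule measurable_completion) simp
  have [measurable]: "fst \<in> borel_measurable (lebesgue \<Otimes>\<^sub>M lebesgue :: ('a \<times> 'a) measure)"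
    "snd \<in> borel_measurable (lebesgue \<Otimes>\<^sub>M lebesgue :: ('a \<times> 'a) measure)"
    by (rule measurable_compose[OF measurable_fst *]) (rule measurable_compose[OF measurable_snd *])
  show ?thesis by measurable
qed

lemma borel_measurable_cnj [measurable]: "cnj \<in> borel_measurable borel"
  by (intro borel_measurable_continuous_onI continuous_intros)

lemma integrable_bounded_times:
  fixes u v :: "'a \<Rightarrow> complex"
  assumes "integrable M u" "v \<in> borel_measurable M" "\<And>x. norm (v x) \<le> B"
  shows "integrable M (\<lambda>x. u x * v x)"
proof (rule Bochner_Integration.integrable_bound)
  show "integrable M (\<lambda>x. B * norm (u x))" using assms(1) by simp
  show "AE x in M. norm (u x * v x) \<le> norm (B * norm (u x))"
  proof (rule AE_I2)
    fix x
    have "0 \<le> B" using assms(3)[of x] norm_ge_zero order_trans by blast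
    then show "norm (u x * v x) \<le> norm (B * norm (u x))"
      using mult_left_mono[OF assms(3)[of x], of "norm (u x)"] by (simp add: norm_mult mult.commute)
  qed
qed (use assms in auto)

definition fourier_inverse :: "(real^'n \<Rightarrow> complex) \<Rightarrow> real^'n \<Rightarrow> complex" where
  "fourier_inverse g x =
     complex_of_real ((2 * pi) powr (- real CARD('n) / 2)) * (LINT \<xi>|lebesgue. g \<xi> * iexp (x \<bullet> \<xi>))"

lemma borel_measurable_inner_lebesgue [measurable]:
  "(\<lambda>\<xi>. x \<bullet> \<xi>) \<in> borel_measurable lebesgue" "(\<lambda>\<xi>. \<xi> \<bullet> x) \<in> borel_measurable lebesgue"
  for x :: "'a::euclidean_space"
  by (auto intro!: measurable_completion borel_measurable_continuous_onI continuous_intros)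

lemma borel_measurable_fourier_inverse [measurable]:
  assumes [measurable]: "g \<in> borel_measurable lebesgue"
  shows "fourier_inverse g \<in> borel_measurable lebesgue"
proof -
  note [measurable] = borel_measurable_lebesgue_inner
  have "(\<lambda>p. g (snd p) * iexp (fst p \<bullet> snd p)) \<in> borel_measurable (lebesgue \<Otimes>\<^sub>M lebesgue)"
    by measurable
  then have [measurable]: "(\<lambda>x. LINT \<xi>|lebesgue. g \<xi> * iexp (x \<bullet> \<xi>)) \<in> borel_measurable lebesgue"
    by (intro lebesgue.borel_measurable_lebesgue_integral) (simp add: case_prod_unfold)
  show ?thesis unfolding fourier_inverse_def[abs_def] by measurable
qed

lemma fourier_integral_eq_inverse: "fourier_integral h \<xi> = fourier_inverse h (- \<xi>)"
  by (simp add: fourier_integral_def fourier_inverse_def inner_commute)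

lemma borel_measurable_fourier_integral [measurable]:
  assumes [measurable]: "h \<in> borel_measurable lebesgue"
  shows "fourier_integral h \<in> borel_measurable lebesgue"
proof -
  note [measurable] = borel_measurable_lebesgue_inner
  have "(\<lambda>p. h (snd p) * exp (- \<i> * complex_of_real (snd p \<bullet> fst p))) \<in> borel_measurable (lebesgue \<Otimes>\<^sub>M lebesgue)"
    by (subst inner_commute) measurable
  then have [measurable]: "(\<lambda>\<xi>. LINT x|lebesgue. h x * exp (- \<i> * complex_of_real (x \<bullet> \<xi>))) \<in> borel_measurable lebesgue"
    by (intro lebesgue.borel_measurable_lebesgue_integral) (simp add: case_prod_unfold)
  show ?thesis unfolding fourier_integral_def[abs_def] by measurable
qed

lemma norm_fourier_inverse_le:
  fixes g :: "real^'n \<Rightarrow> complex"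
  shows "norm (fourier_inverse g x) \<le> (2 * pi) powr (- real CARD('n) / 2) * (LINT \<xi>|lebesgue. norm (g \<xi>))"
proof -
  have "norm (LINT \<xi>|lebesgue. g \<xi> * iexp (x \<bullet> \<xi>)) \<le> (LINT \<xi>|lebesgue. norm (g \<xi> * iexp (x \<bullet> \<xi>)))"
    by (rule integral_norm_bound)
  also have "\<dots> = (LINT \<xi>|lebesgue. norm (g \<xi>))"
    by (simp add: norm_mult)
  finally show ?thesis
    unfolding fourier_inverse_def by (simp add: norm_mult mult_left_mono)
qed

text \<open>Fubini for g(\<xi>) exp(i x.\<xi>) cnj(H(x)), which is absolutely integrable because
  both functions are. The later transform identities are limits or instances of this one.\<close>

lemma fourier_parseval:
  fixes g H :: "real^'n \<Rightarrow> complex"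
  assumes g: "integrable lebesgue g" and H: "integrable lebesgue H"
  shows "(LINT x|lebesgue. fourier_inverse g x * cnj (H x)) = (LINT \<xi>|lebesgue. g \<xi> * cnj (fourier_integral H \<xi>))"
proof -
  note [measurable] = borel_measurable_lebesgue_inner
  have [measurable]: "g \<in> borel_measurable lebesgue" "H \<in> borel_measurable lebesgue"
    using g H by auto
  let ?c = "complex_of_real ((2 * pi) powr (- real CARD('n) / 2))"
  define F where "F x \<xi> = g \<xi> * iexp (x \<bullet> \<xi>) * cnj (H x)" for x \<xi> :: "real^'n"
  have m: "(\<lambda>p. F (fst p) (snd p)) \<in> borel_measurable (lebesgue \<Otimes>\<^sub>M lebesgue)"
    unfolding F_def by measurable
  have "integrable (lebesgue \<Otimes>\<^sub>M lebesgue) (\<lambda>p. F (fst p) (snd p))"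
  proof (rule lebesgue_pair.Fubini_integrable[OF m])
    show "AE x in lebesgue. integrable lebesgue (\<lambda>\<xi>. F (fst (x, \<xi>)) (snd (x, \<xi>)))"
    proof (rule AE_I2)
      fix x
      show "integrable lebesgue (\<lambda>\<xi>. F (fst (x, \<xi>)) (snd (x, \<xi>)))"
        unfolding F_def fst_conv snd_conv
        by (intro integrable_mult_left integrable_bounded_times[OF g, of _ 1]) auto
    qed
    have "integrable lebesgue (\<lambda>x. (LINT \<xi>|lebesgue. norm (g \<xi>)) * norm (H x))"
      using H by simp
    then show "integrable lebesgue (\<lambda>x. LINT \<xi>|lebesgue. norm (F (fst (x, \<xi>)) (snd (x, \<xi>))))"
      by (simp add: F_def norm_mult)
  qed
  then have "(LINT \<xi>|lebesgue. (LINT x|lebesgue. F x \<xi>)) = (LINT x|lebesgue. (LINT \<xi>|lebesgue. F x \<xi>))"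
    by (intro lebesgue_pair.Fubini_integral) (simp add: case_prod_unfold)
  moreover have "(LINT x|lebesgue. F x \<xi>) = g \<xi> * cnj (LINT x|lebesgue. H x * exp (- \<i> * complex_of_real (x \<bullet> \<xi>)))" for \<xi>
    unfolding Bochner_Integration.integral_cnj[symmetric] F_def
    by (subst integral_mult_right_zero[symmetric]) (simp add: exp_cnj mult_ac)
  moreover have "(LINT \<xi>|lebesgue. F x \<xi>) = (LINT \<xi>|lebesgue. g \<xi> * iexp (x \<bullet> \<xi>)) * cnj (H x)" for x
    unfolding F_def by simp
  ultimately have "?c * (LINT x|lebesgue. (LINT \<xi>|lebesgue. g \<xi> * iexp (x \<bullet> \<xi>)) * cnj (H x))
      = ?c * (LINT \<xi>|lebesgue. g \<xi> * cnj (LINT x|lebesgue. H x * exp (- \<i> * complex_of_real (x \<bullet> \<xi>))))"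
    by simp
  then show ?thesis
    unfolding fourier_inverse_def fourier_integral_def complex_cnj_mult complex_cnj_complex_of_real
      mult.assoc mult.left_commute[of "g _" ?c] integral_mult_right_zero .
qed

lemma integrable_L2_times:
  fixes a b :: "'a \<Rightarrow> complex"
  assumes [measurable]: "a \<in> borel_measurable M" "b \<in> borel_measurable M"
    and "integrable M (\<lambda>x. (norm (a x))\<^sup>2)" "integrable M (\<lambda>x. (norm (b x))\<^sup>2)"
  shows "integrable M (\<lambda>x. a x * b x)"
proof (rule Bochner_Integration.integrable_bound)
  show "integrable M (\<lambda>x. (norm (a x))\<^sup>2 + (norm (b x))\<^sup>2)" using assms by simp
  show "AE x in M. norm (a x * b x) \<le> norm ((norm (a x))\<^sup>2 + (norm (b x))\<^sup>2)"
  proof (rule AE_I2)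
    fix x
    have "2 * (norm (a x) * norm (b x)) \<le> (norm (a x))\<^sup>2 + (norm (b x))\<^sup>2"
      using sum_squares_bound[of "norm (a x)" "norm (b x)"] by simp
    then have "norm (a x) * norm (b x) \<le> (norm (a x))\<^sup>2 + (norm (b x))\<^sup>2"
      using mult_nonneg_nonneg[OF norm_ge_zero[of "a x"] norm_ge_zero[of "b x"]] by linarith
    then show "norm (a x * b x) \<le> norm ((norm (a x))\<^sup>2 + (norm (b x))\<^sup>2)"
      by (simp add: norm_mult)
  qed
qed auto

text \<open>Cauchy-Schwarz is replaced by |a| |b| \<le> \<delta> |a|^2 + |b|^2 / \<delta>, which
  integrates termwise even in the extended nonnegative reals, where the distances live.\<close>

lemma L2_pairing_tendsto:
  fixes a b :: "'a \<Rightarrow> complex" and d :: "nat \<Rightarrow> 'a \<Rightarrow> complex"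
  assumes [measurable]: "a \<in> borel_measurable M" "b \<in> borel_measurable M" "\<And>k. d k \<in> borel_measurable M"
    and a: "integrable M (\<lambda>x. (norm (a x))\<^sup>2)"
    and ab: "integrable M (\<lambda>x. a x * cnj (b x))" and ad: "\<And>k. integrable M (\<lambda>x. a x * cnj (d k x))"
    and lim: "(\<lambda>k. \<integral>\<^sup>+x. ennreal ((norm (d k x - b x))\<^sup>2) \<partial>M) \<longlonglongrightarrow> 0"
  shows "(\<lambda>k. LINT x|M. a x * cnj (d k x)) \<longlonglongrightarrow> (LINT x|M. a x * cnj (b x))"
proof (rule metric_LIMSEQ_I)
  fix e :: real assume "e > 0"
  define A where "A = (LINT x|M. (norm (a x))\<^sup>2)"
  have A: "A \<ge> 0" "(\<integral>\<^sup>+x. ennreal ((norm (a x))\<^sup>2) \<partial>M) = ennreal A"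
    unfolding A_def using a by (auto simp: nn_integral_eq_integral)
  \<comment> \<open>Makes the first summand \<delta> A at most e/2; the \<open>+ 1\<close> covers A
    = 0. The distance is then required to be below \<delta> e/2, so that the second summand is below
    e/2.\<close>
  define \<delta> where "\<delta> = e / (2 * (A + 1))"
  have \<delta>: "\<delta> > 0" "\<delta> * A \<le> e / 2"
    using \<open>e > 0\<close> A(1) by (auto simp: \<delta>_def field_simps)
  have "\<forall>\<^sub>F k in sequentially. (\<integral>\<^sup>+x. ennreal ((norm (d k x - b x))\<^sup>2) \<partial>M) < ennreal (\<delta> * (e / 2))"
    by (rule order_tendstoD(2)[OF lim]) (use \<delta> \<open>e > 0\<close> in simp)
  then obtain N where N: "\<And>k. k \<ge> N \<Longrightarrow> (\<integral>\<^sup>+x. ennreal ((norm (d k x - b x))\<^sup>2) \<partial>M) < ennreal (\<delta> * (e / 2))"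
    by (auto simp: eventually_sequentially)
  show "\<exists>N. \<forall>k\<ge>N. dist (LINT x|M. a x * cnj (d k x)) (LINT x|M. a x * cnj (b x)) < e"
  proof (intro exI allI impI)
    fix k assume "k \<ge> N"
    let ?E = "\<integral>\<^sup>+x. ennreal ((norm (d k x - b x))\<^sup>2) \<partial>M"
    have eq: "(LINT x|M. a x * cnj (d k x)) - (LINT x|M. a x * cnj (b x)) = (LINT x|M. a x * cnj (d k x - b x))"
      using ab ad by (simp add: algebra_simps)
    have "integrable M (\<lambda>x. a x * cnj (d k x) - a x * cnj (b x))"
      using ab ad by (rule Bochner_Integration.integrable_diff[rotated])
    then have int: "integrable M (\<lambda>x. a x * cnj (d k x - b x))" by (simp add: algebra_simps)
    have "ennreal (norm (LINT x|M. a x * cnj (d k x - b x))) \<le> (\<integral>\<^sup>+x. norm (a x * cnj (d k x - b x)) \<partial>M)"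
      by (rule integral_norm_bound_ennreal[OF int])
    also have "\<dots> \<le> (\<integral>\<^sup>+x. ennreal \<delta> * ennreal ((norm (a x))\<^sup>2) + ennreal (1 / \<delta>) * ennreal ((norm (d k x - b x))\<^sup>2) \<partial>M)"
    proof (rule nn_integral_mono)
      fix x
      let ?u = "norm (a x)" and ?v = "norm (d k x - b x)"
      have "2 * (?u * ?v) \<le> \<delta> * ?u\<^sup>2 + (1 / \<delta>) * ?v\<^sup>2"
      proof -
        have "0 \<le> (\<delta> * ?u - ?v)\<^sup>2 / \<delta>" using \<delta> by simp
        also have "\<dots> = \<delta> * ?u\<^sup>2 + (1 / \<delta>) * ?v\<^sup>2 - 2 * (?u * ?v)"
          using \<delta> by (simp add: field_simps power2_eq_square)
        finally show ?thesis by simp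
      qed
      moreover have "0 \<le> ?u * ?v" by simp
      ultimately have "?u * ?v \<le> \<delta> * ?u\<^sup>2 + (1 / \<delta>) * ?v\<^sup>2" by linarith
      then have "norm (a x * cnj (d k x - b x)) \<le> \<delta> * ?u\<^sup>2 + (1 / \<delta>) * ?v\<^sup>2"
        by (simp only: norm_mult complex_mod_cnj)
      then have "ennreal (norm (a x * cnj (d k x - b x))) \<le> ennreal (\<delta> * ?u\<^sup>2 + (1 / \<delta>) * ?v\<^sup>2)"
        by (rule ennreal_leI)
      also have "\<dots> = ennreal \<delta> * ennreal (?u\<^sup>2) + ennreal (1 / \<delta>) * ennreal (?v\<^sup>2)"
        using \<delta> by (simp add: ennreal_plus ennreal_mult[symmetric] del: ennreal_plus[symmetric])
      finally show "ennreal (norm (a x * cnj (d k x - b x))) \<le> ennreal \<delta> * ennreal (?u\<^sup>2) + ennreal (1 / \<delta>) * ennreal (?v\<^sup>2)" .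
    qed
    also have "\<dots> = ennreal \<delta> * ennreal A + ennreal (1 / \<delta>) * ?E"
      by (simp add: nn_integral_add nn_integral_cmult A(2))
    also have "\<dots> < ennreal e"
    proof -
      obtain E where E: "E \<ge> 0" "?E = ennreal E" using N[OF \<open>k \<ge> N\<close>] by (cases ?E) auto
      have "E < \<delta> * (e / 2)" using N[OF \<open>k \<ge> N\<close>] E by (simp add: ennreal_less_iff)
      then have "(1 / \<delta>) * E < e / 2" using \<delta>(1) by (simp add: field_simps)
      then have "\<delta> * A + (1 / \<delta>) * E < e" using \<delta>(2) by linarith
      then show ?thesis
        using \<delta>(1) A(1) E by (simp add: ennreal_mult[symmetric] ennreal_plus[symmetric] ennreal_less_iff del: ennreal_plus)
    qed
    finally show "dist (LINT x|M. a x * cnj (d k x)) (LINT x|M. a x * cnj (b x)) < e"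
      unfolding dist_norm eq using \<open>e > 0\<close> by (simp add: ennreal_less_iff)
  qed
qed

section \<open>The wavelet integral on the Fourier side\<close>

lemma fourier_integral_shift_scale:
  fixes h :: "real^'n \<Rightarrow> complex"
  assumes "t > 0" and h: "integrable lebesgue h"
  shows "fourier_integral (\<lambda>x. h ((x - y) /\<^sub>R t)) \<xi> =
    complex_of_real (t ^ CARD('n)) * exp (- \<i> * complex_of_real (y \<bullet> \<xi>)) * fourier_integral h (t *\<^sub>R \<xi>)"
proof -
  define G where "G z = h z * (exp (- \<i> * complex_of_real (y \<bullet> \<xi>)) * exp (- \<i> * complex_of_real (z \<bullet> (t *\<^sub>R \<xi>))))" for z
  have G: "integrable lebesgue G"
    unfolding G_def by (rule integrable_bounded_times[OF h, of _ 1]) (auto simp: norm_mult)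
  have eq: "h ((x - y) /\<^sub>R t) * exp (- \<i> * complex_of_real (x \<bullet> \<xi>)) = G ((x - y) /\<^sub>R t)" for x
  proof -
    have "y \<bullet> \<xi> + ((x - y) /\<^sub>R t) \<bullet> (t *\<^sub>R \<xi>) = x \<bullet> \<xi>"
    proof -
      have "((x - y) /\<^sub>R t) \<bullet> (t *\<^sub>R \<xi>) = (x - y) \<bullet> \<xi>" using assms(1) by simp
      then have "y \<bullet> \<xi> + ((x - y) /\<^sub>R t) \<bullet> (t *\<^sub>R \<xi>) = (y + (x - y)) \<bullet> \<xi>"
        unfolding inner_add_left by presburger
      then show ?thesis by simp
    qed
    then have "exp (- \<i> * complex_of_real (x \<bullet> \<xi>)) = exp (- \<i> * complex_of_real (y \<bullet> \<xi>) + - \<i> * complex_of_real (((x - y) /\<^sub>R t) \<bullet> (t *\<^sub>R \<xi>)))"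
      by (metis distrib_left of_real_add)
    then show ?thesis unfolding G_def by (simp only: exp_add)
  qed
  show ?thesis
    unfolding fourier_integral_def eq integral_shift_scale[OF assms(1) G]
    unfolding G_def mult.left_commute[of "h _"] integral_mult_right_zero by (simp add: scaleR_conv_of_real)
qed

text \<open>Only the approximants of the window are integrable, so Parseval is applied to each of
  them. Both sides then converge as L2 pairings: on the left with the dilated windows, on the right
  with the dilated transforms.\<close>

lemma wavelet_inner_product:
  fixes g \<psi> g\<psi> :: "real^'n \<Rightarrow> complex"
  assumes g: "integrable lebesgue g" and g2: "integrable lebesgue (\<lambda>\<xi>. (norm (g \<xi>))\<^sup>2)"
    and f2: "L2_function (fourier_inverse g)" and \<psi>: "is_fourier_L2 \<psi> g\<psi>" and "t > 0"
  shows "(LINT x|lebesgue. fourier_inverse g x * cnj (\<psi> ((x - y) /\<^sub>R t))) =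
    complex_of_real (t ^ CARD('n)) * (LINT \<xi>|lebesgue. g \<xi> * iexp (y \<bullet> \<xi>) * cnj (g\<psi> (t *\<^sub>R \<xi>)))"
proof -
  obtain h :: "nat \<Rightarrow> real^'n \<Rightarrow> complex" where h: "\<And>k. integrable lebesgue (h k)" "\<And>k. L2_function (h k)"
    and lim1: "(\<lambda>k. \<integral>\<^sup>+x. ennreal ((cmod (h k x - \<psi> x))\<^sup>2) \<partial>lebesgue) \<longlonglongrightarrow> 0"
    and lim2: "(\<lambda>k. \<integral>\<^sup>+\<xi>. ennreal ((cmod (fourier_integral (h k) \<xi> - g\<psi> \<xi>))\<^sup>2) \<partial>lebesgue) \<longlonglongrightarrow> 0"
    using \<psi> unfolding is_fourier_L2_def by blast
  have meas[measurable]: "g \<in> borel_measurable lebesgue" "\<psi> \<in> borel_measurable lebesgue" "g\<psi> \<in> borel_measurable lebesgue"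
      "\<And>k. h k \<in> borel_measurable lebesgue"
    and \<psi>2: "integrable lebesgue (\<lambda>x. (cmod (\<psi> x))\<^sup>2)" "integrable lebesgue (\<lambda>x. (cmod (g\<psi> x))\<^sup>2)"
      "\<And>k. integrable lebesgue (\<lambda>x. (cmod (h k x))\<^sup>2)"
    using g \<psi> h unfolding is_fourier_L2_def L2_function_def by auto
  have f2': "integrable lebesgue (\<lambda>x. (cmod (fourier_inverse g x))\<^sup>2)" using f2 by (simp add: L2_function_def)
  have T[measurable]: "(\<lambda>x. (x - y) /\<^sub>R t) \<in> lebesgue \<rightarrow>\<^sub>M lebesgue"
    by (rule measurable_lebesgue_shift_scale[OF \<open>t > 0\<close>])
  \<comment> \<open>Writes dilation by \<open>t\<close> as a shift-scale map with shift 0 and factor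
    1/t, so that the substitution rules apply on the frequency side too.\<close>
  have S: "t *\<^sub>R \<xi> = (\<xi> - 0) /\<^sub>R (1 / t)" for \<xi> :: "real^'n" by simp
  have t': "1 / t > 0" using \<open>t > 0\<close> by simp
  have [measurable]: "(\<lambda>\<xi>. t *\<^sub>R \<xi>) \<in> lebesgue \<rightarrow>\<^sub>M (lebesgue :: (real^'n) measure)"
    unfolding S by (rule measurable_lebesgue_shift_scale[OF t'])
  let ?H = "\<lambda>k x. h k ((x - y) /\<^sub>R t)"
  have L1: "(\<lambda>k. LINT x|lebesgue. fourier_inverse g x * cnj (?H k x))
      \<longlonglongrightarrow> (LINT x|lebesgue. fourier_inverse g x * cnj (\<psi> ((x - y) /\<^sub>R t)))"
  proof (rule L2_pairing_tendsto)
    show "integrable lebesgue (\<lambda>x. fourier_inverse g x * cnj (\<psi> ((x - y) /\<^sub>R t)))"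
      by (rule integrable_L2_times)
        (use f2' integrable_shift_scale[OF \<open>t > 0\<close> \<psi>2(1), of y] in auto)
    show "integrable lebesgue (\<lambda>x. fourier_inverse g x * cnj (?H k x))" for k
      by (rule integrable_L2_times)
        (use f2' integrable_shift_scale[OF \<open>t > 0\<close> \<psi>2(3), where y = y] in auto)
    have "(\<integral>\<^sup>+x. ennreal ((cmod (?H k x - \<psi> ((x - y) /\<^sub>R t)))\<^sup>2) \<partial>lebesgue)
        = ennreal (t ^ DIM(real^'n)) * (\<integral>\<^sup>+x. ennreal ((cmod (h k x - \<psi> x))\<^sup>2) \<partial>lebesgue)" for k
      using nn_integral_shift_scale[OF \<open>t > 0\<close>, of "\<lambda>x. ennreal ((cmod (h k x - \<psi> x))\<^sup>2)" y] by simp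
    then show "(\<lambda>k. \<integral>\<^sup>+x. ennreal ((cmod (?H k x - \<psi> ((x - y) /\<^sub>R t)))\<^sup>2) \<partial>lebesgue) \<longlonglongrightarrow> 0"
      using ennreal_tendsto_cmult[OF _ lim1, of "ennreal (t ^ DIM(real^'n))"] by simp
  qed (use f2' in measurable)
  have eq: "(LINT x|lebesgue. fourier_inverse g x * cnj (?H k x)) =
      complex_of_real (t ^ CARD('n)) * (LINT \<xi>|lebesgue. g \<xi> * iexp (y \<bullet> \<xi>) * cnj (fourier_integral (h k) (t *\<^sub>R \<xi>)))" for k
    unfolding fourier_parseval[OF g integrable_shift_scale[OF \<open>t > 0\<close> h(1)]] fourier_integral_shift_scale[OF \<open>t > 0\<close> h(1)]
    by (simp add: exp_cnj mult_ac del: integral_mult_right_zero flip: integral_mult_right_zero)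
  have "(\<lambda>k. LINT \<xi>|lebesgue. g \<xi> * iexp (y \<bullet> \<xi>) * cnj (fourier_integral (h k) (t *\<^sub>R \<xi>)))
     \<longlonglongrightarrow> (LINT \<xi>|lebesgue. g \<xi> * iexp (y \<bullet> \<xi>) * cnj (g\<psi> (t *\<^sub>R \<xi>)))"
  proof (rule L2_pairing_tendsto)
    show "integrable lebesgue (\<lambda>\<xi>. (cmod (g \<xi> * iexp (y \<bullet> \<xi>)))\<^sup>2)"
      using g2 by (simp add: norm_mult)
    show "integrable lebesgue (\<lambda>\<xi>. g \<xi> * iexp (y \<bullet> \<xi>) * cnj (g\<psi> (t *\<^sub>R \<xi>)))"
      by (rule integrable_L2_times)
        (use g2 integrable_shift_scale[OF t' \<psi>2(2), of 0] in \<open>auto simp: norm_mult\<close>)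
    show "integrable lebesgue (\<lambda>\<xi>. g \<xi> * iexp (y \<bullet> \<xi>) * cnj (fourier_integral (h k) (t *\<^sub>R \<xi>)))" for k
    proof (rule integrable_bounded_times)
      show "integrable lebesgue (\<lambda>\<xi>. g \<xi> * iexp (y \<bullet> \<xi>))"
        by (rule integrable_bounded_times[OF g, of _ 1]) auto
      show "cmod (cnj (fourier_integral (h k) (t *\<^sub>R \<xi>))) \<le> (2 * pi) powr (- real CARD('n) / 2) * (LINT \<xi>|lebesgue. norm (h k \<xi>))" for \<xi>
        using norm_fourier_inverse_le[of "h k" "- (t *\<^sub>R \<xi>)"] by (simp add: fourier_integral_eq_inverse)
    qed measurable
    have "(\<integral>\<^sup>+x. ennreal ((cmod (fourier_integral (h k) (t *\<^sub>R x) - g\<psi> (t *\<^sub>R x)))\<^sup>2) \<partial>lebesgue)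
        = ennreal ((1 / t) ^ DIM(real^'n)) * (\<integral>\<^sup>+x. ennreal ((cmod (fourier_integral (h k) x - g\<psi> x))\<^sup>2) \<partial>lebesgue)" for k
      using nn_integral_shift_scale[OF t', of "\<lambda>x. ennreal ((cmod (fourier_integral (h k) x - g\<psi> x))\<^sup>2)" 0] by simp
    then show "(\<lambda>k. \<integral>\<^sup>+x. ennreal ((cmod (fourier_integral (h k) (t *\<^sub>R x) - g\<psi> (t *\<^sub>R x)))\<^sup>2) \<partial>lebesgue) \<longlonglongrightarrow> 0"
      using ennreal_tendsto_cmult[OF _ lim2, of "ennreal ((1 / t) ^ DIM(real^'n))"] by simp
  qed measurable
  then have "(\<lambda>k. complex_of_real (t ^ CARD('n)) * (LINT \<xi>|lebesgue. g \<xi> * iexp (y \<bullet> \<xi>) * cnj (fourier_integral (h k) (t *\<^sub>R \<xi>))))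
     \<longlonglongrightarrow> complex_of_real (t ^ CARD('n)) * (LINT \<xi>|lebesgue. g \<xi> * iexp (y \<bullet> \<xi>) * cnj (g\<psi> (t *\<^sub>R \<xi>)))"
    by (rule tendsto_mult_left)
  then show ?thesis
    by (rule LIMSEQ_unique[OF L1[unfolded eq]])
qed

section \<open>Gaussian damping and Fourier inversion in L2\<close>

abbreviation gauss :: "real^'n \<Rightarrow> complex" where
  "gauss x \<equiv> complex_of_real (exp (- (norm x)\<^sup>2 / 2))"

lemma fourier_integral_gauss: "fourier_integral gauss \<xi> = gauss \<xi>" for \<xi> :: "real^'n"
proof -
  have "(LINT x|lebesgue. gauss x * exp (- \<i> * complex_of_real (x \<bullet> \<xi>)))
      = complex_of_real ((2 * pi) powr (real CARD('n) / 2) * exp (- (norm \<xi>)\<^sup>2 / 2))"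
    using has_bochner_integral_gaussian_iexp[of "- \<xi>"]
    by (simp add: has_bochner_integral_iff inner_commute)
  moreover have "(2 * pi) powr (- real CARD('n) / 2) * (2 * pi) powr (real CARD('n) / 2) = 1"
    by (simp add: powr_add[symmetric])
  ultimately show ?thesis
    unfolding fourier_integral_def
    by (simp only: of_real_mult[symmetric] mult.assoc[symmetric]) simp
qed

lemma integrable_gauss: "integrable lebesgue (gauss :: real^'n \<Rightarrow> complex)"
  using has_bochner_integral_gaussian_iexp[of "0::real^'n"] by (simp add: has_bochner_integral_iff)

lemma borel_measurable_lebesgue_continuous:
  fixes g :: "'a::euclidean_space \<Rightarrow> 'b::topological_space"
  shows "continuous_on UNIV g \<Longrightarrow> g \<in> borel_measurable lebesgue"
  by (intro measurable_completion) (simp add: borel_measurable_continuous_onI)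

text \<open>If \<open>f\<close> is not integrable, its integral is 0 by convention, and the integral
  of \<open>w\<close> is nonnegative.\<close>

lemma norm_integral_le_dominating:
  fixes f :: "'a \<Rightarrow> 'b::{banach,second_countable_topology}"
  assumes w: "integrable M w" and le: "\<And>x. norm (f x) \<le> w x"
  shows "norm (LINT x|M. f x) \<le> (LINT x|M. w x)"
proof -
  have "0 \<le> w x" for x using order_trans[OF norm_ge_zero le] .
  then have "norm (f x) \<le> norm (w x)" for x using le[of x] by simp
  then have "integrable M f" if "f \<in> borel_measurable M"
    using Bochner_Integration.integrable_bound[OF w that] by simp
  then show ?thesis
    using le \<open>\<And>x. 0 \<le> w x\<close> w
    by (cases "integrable M f") (auto intro!: integral_mono order_trans[OF integral_norm_bound] simp: not_integrable_integral_eq integral_nonneg)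
qed

text \<open>Multiplication by a wide Gaussian turns into convolution with a narrow one.\<close>

lemma fourier_integral_damped_inverse:
  fixes g :: "real^'n \<Rightarrow> complex"
  assumes g: "integrable lebesgue g" and G: "continuous_on UNIV g" and "s > 0"
  shows "fourier_integral (\<lambda>x. fourier_inverse g x * gauss (x /\<^sub>R s)) \<xi> =
     complex_of_real ((2 * pi) powr (- real CARD('n) / 2)) * (LINT z|lebesgue. g (\<xi> + z /\<^sub>R s) * gauss z)"
    (is "_ = ?c * _")
proof -
  define \<gamma> where "\<gamma> x = gauss ((x - 0) /\<^sub>R s)" for x :: "real^'n"
  \<comment> \<open>Chosen so that \<open>cnj (H x)\<close> is the Gaussian times exp(-i x.\<xi>):
    the transform of the damped function at \<xi> becomes a Parseval pairing with \<open>H\<close>,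
    whose transform is a Gaussian centred at \<xi>.\<close>
  define H where "H x = \<gamma> x * iexp (x \<bullet> \<xi>)" for x
  have \<gamma>: "integrable lebesgue \<gamma>"
    unfolding \<gamma>_def by (rule integrable_shift_scale[OF \<open>s > 0\<close> integrable_gauss])
  have H: "integrable lebesgue H"
    unfolding H_def by (rule integrable_bounded_times[OF \<gamma>, of _ 1]) auto
  have FH: "fourier_integral H \<eta> = complex_of_real (s ^ CARD('n)) * gauss (s *\<^sub>R (\<eta> - \<xi>))" for \<eta>
  proof -
    have "iexp (x \<bullet> \<xi>) * exp (- \<i> * complex_of_real (x \<bullet> \<eta>)) = exp (- \<i> * complex_of_real (x \<bullet> (\<eta> - \<xi>)))" for x
      by (simp add: exp_add[symmetric] algebra_simps inner_diff_right)
    then have "fourier_integral H \<eta> = fourier_integral \<gamma> (\<eta> - \<xi>)"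
      by (simp add: fourier_integral_def H_def mult.assoc)
    also have "\<dots> = complex_of_real (s ^ CARD('n)) * gauss (s *\<^sub>R (\<eta> - \<xi>))"
      unfolding \<gamma>_def fourier_integral_shift_scale[OF \<open>s > 0\<close> integrable_gauss] fourier_integral_gauss by simp
    finally show ?thesis .
  qed
  have "cnj (H x) = gauss (x /\<^sub>R s) * exp (- \<i> * complex_of_real (x \<bullet> \<xi>))" for x
    by (simp add: H_def \<gamma>_def exp_cnj)
  then have "fourier_integral (\<lambda>x. fourier_inverse g x * gauss (x /\<^sub>R s)) \<xi> =
      ?c * (LINT x|lebesgue. fourier_inverse g x * cnj (H x))"
    by (simp add: fourier_integral_def mult.assoc)
  also have "\<dots> = ?c * (LINT \<eta>|lebesgue. g \<eta> * cnj (fourier_integral H \<eta>))"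
    by (simp only: fourier_parseval[OF g H])
  also have "\<dots> = ?c * (LINT \<eta>|lebesgue. g \<eta> * cnj (complex_of_real (s ^ CARD('n)) * gauss (s *\<^sub>R (\<eta> - \<xi>))))"
    by (simp only: FH)
  also have "(LINT \<eta>|lebesgue. g \<eta> * cnj (complex_of_real (s ^ CARD('n)) * gauss (s *\<^sub>R (\<eta> - \<xi>))))
      = complex_of_real (s ^ CARD('n)) * (LINT \<eta>|lebesgue. g \<eta> * gauss (s *\<^sub>R (\<eta> - \<xi>)))"
    unfolding complex_cnj_mult complex_cnj_complex_of_real mult.left_commute[of "g _"] integral_mult_right_zero ..
  also have "(LINT \<eta>|lebesgue. g \<eta> * gauss (s *\<^sub>R (\<eta> - \<xi>))) = complex_of_real ((1 / s) ^ CARD('n)) * (LINT z|lebesgue. g (\<xi> + z /\<^sub>R s) * gauss z)"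
  proof -
    have 1: "1 / s > 0" using \<open>s > 0\<close> by simp
    have 2: "integrable lebesgue (\<lambda>z. g (\<xi> + z /\<^sub>R s) * gauss z)"
    proof (rule integrable_bounded_times)
      show "integrable lebesgue (\<lambda>z. g (\<xi> + z /\<^sub>R s))"
        using integrable_shift_scale[OF \<open>s > 0\<close> g, of "- s *\<^sub>R \<xi>"] \<open>s > 0\<close>
        by (simp add: scaleR_add_right add.commute)
      show "cmod (gauss z) \<le> 1" for z :: "real^'n" by simp
    qed (use borel_measurable_integrable[OF integrable_gauss] in auto)
    have 3: "(\<eta> - \<xi>) /\<^sub>R (1 / s) = s *\<^sub>R (\<eta> - \<xi>)" "\<xi> + (s *\<^sub>R (\<eta> - \<xi>)) /\<^sub>R s = \<eta>" for \<eta>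
      using \<open>s > 0\<close> by simp_all
    have "(LINT \<eta>|lebesgue. g \<eta> * gauss (s *\<^sub>R (\<eta> - \<xi>))) = (1 / s) ^ DIM(real^'n) *\<^sub>R (LINT z|lebesgue. g (\<xi> + z /\<^sub>R s) * gauss z)"
      using integral_shift_scale[OF 1 2, of \<xi>] unfolding 3 .
    then show ?thesis by (simp add: scaleR_conv_of_real)
  qed
  finally show ?thesis
    using \<open>s > 0\<close> by (simp add: power_one_over)
qed

text \<open>The approximants are the inverse transform times Gaussians of width k+1. Their
  transforms are averages of \<open>g\<close> around \<xi>, hence converge to \<open>g\<close>
  pointwise, and a fixed Gaussian in \<xi> dominates them. This bound also yields square
  integrability of the inverse transform.\<close>

lemma is_fourier_L2_inverse:
  fixes g :: "real^'n \<Rightarrow> complex"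
  assumes cont: "continuous_on UNIV g" and supp: "\<And>\<xi>. g \<xi> \<noteq> 0 \<Longrightarrow> norm \<xi> \<le> R"
  shows "integrable lebesgue g" "integrable lebesgue (\<lambda>\<xi>. (cmod (g \<xi>))\<^sup>2)"
    "is_fourier_L2 (fourier_inverse g) g"
proof -
  have [measurable]: "g \<in> borel_measurable lebesgue"
    by (rule borel_measurable_lebesgue_continuous[OF cont])
  have cont_at: "isCont g x" for x using cont by (simp add: continuous_on_eq_continuous_at)
  obtain B where B: "\<And>\<xi>. cmod (g \<xi>) \<le> B" "B \<ge> 0"
  proof -
    have "compact (g ` cball 0 R)"
      by (intro compact_continuous_image continuous_on_subset[OF cont]) auto
    then obtain b where b: "\<forall>z \<in> g ` cball 0 R. cmod z \<le> b" using compact_imp_bounded bounded_iff by blast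
    have "cmod (g \<xi>) \<le> max b 0" for \<xi>
    proof (cases "g \<xi> = 0")
      case False
      then have "g \<xi> \<in> g ` cball 0 R" using supp[of \<xi>] by simp
      with b have "cmod (g \<xi>) \<le> b" by blast
      then show ?thesis by simp
    qed simp
    then show ?thesis using that[of "max b 0"] by simp
  qed
  define c where "c = (2 * pi) powr (- real CARD('n) / 2)"
  have c: "c > 0" by (simp add: c_def)
  define u where "u a x = exp (- a * (norm (x::real^'n))\<^sup>2)" for a x
  have u: "integrable lebesgue (u a)" if "a > 0" for a
    unfolding u_def[abs_def] by (rule integrable_gaussian[OF that])
  define D where "D = c * (B * exp (R\<^sup>2 / 4) * (LINT z|lebesgue. u (1/4) z))"
  \<comment> \<open>Where \<open>g\<close> does not vanish, |\<xi>| \<le> R + |z|, hence |\<xi>|^2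
    \<le> 2 R^2 + 2 |z|^2. Half of the decay in \<open>z\<close> is traded for decay in \<xi>,
    uniformly in s \<ge> 1; dividing by 8 gives the exponents.\<close>
  have key: "cmod (g (\<xi> + z /\<^sub>R s) * gauss z) \<le> B * exp (R\<^sup>2 / 4) * u (1/8) \<xi> * u (1/4) z" if "s \<ge> 1" for s \<xi> z
  proof (cases "g (\<xi> + z /\<^sub>R s) = 0")
    case False
    have "norm \<xi> \<le> norm (\<xi> + z /\<^sub>R s) + norm (z /\<^sub>R s)"
      using norm_triangle_ineq4[of "\<xi> + z /\<^sub>R s" "z /\<^sub>R s"] by simp
    also have "\<dots> \<le> R + norm z"
    proof -
      have "norm z * inverse s \<le> norm z * 1"
        using that by (intro mult_left_mono) (auto simp: inverse_le_1_iff)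
      then show ?thesis using supp[OF False] that by (simp add: mult.commute)
    qed
    finally have "(norm \<xi>)\<^sup>2 \<le> (R + norm z)\<^sup>2" by (intro power_mono) auto
    also have "\<dots> \<le> 2 * R\<^sup>2 + 2 * (norm z)\<^sup>2"
      using sum_squares_bound[of R "norm z"] by (simp add: power2_sum)
    finally have "- (norm z)\<^sup>2 / 2 \<le> R\<^sup>2 / 4 + (- (1/8) * (norm \<xi>)\<^sup>2) + (- (1/4) * (norm z)\<^sup>2)" by simp
    then have "exp (- (norm z)\<^sup>2 / 2) \<le> exp (R\<^sup>2 / 4) * u (1/8) \<xi> * u (1/4) z"
      unfolding u_def exp_add[symmetric] by simp
    then have "cmod (g (\<xi> + z /\<^sub>R s)) * exp (- (norm z)\<^sup>2 / 2) \<le> B * (exp (R\<^sup>2 / 4) * u (1/8) \<xi> * u (1/4) z)"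
      using B by (intro mult_mono) auto
    then show ?thesis by (simp add: norm_mult mult_ac)
  qed (use B in \<open>simp add: u_def\<close>)
  have gle: "cmod (g \<xi>) \<le> B * exp (R\<^sup>2 / 4) * u (1/8) \<xi>" for \<xi>
    using key[of 1 \<xi> 0] by (simp add: u_def)
  show g: "integrable lebesgue g"
    by (rule Bochner_Integration.integrable_bound[of _ "\<lambda>\<xi>. B * exp (R\<^sup>2 / 4) * u (1/8) \<xi>"])
      (use u order_trans[OF gle abs_ge_self] in simp_all)
  have usq: "(u a x)\<^sup>2 = u (2 * a) x" for a x
    by (simp add: u_def exp_double[symmetric] power2_eq_square exp_add[symmetric])
  show g2: "integrable lebesgue (\<lambda>\<xi>. (cmod (g \<xi>))\<^sup>2)"
  proof (rule Bochner_Integration.integrable_bound)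
    show "integrable lebesgue (\<lambda>\<xi>. (B * exp (R\<^sup>2 / 4))\<^sup>2 * u (2 * (1/8)) \<xi>)" using u by simp
    show "AE \<xi> in lebesgue. norm ((cmod (g \<xi>))\<^sup>2) \<le> norm ((B * exp (R\<^sup>2 / 4))\<^sup>2 * u (2 * (1/8)) \<xi>)"
      using power_mono[OF gle norm_ge_zero, where n = 2] unfolding power_mult_distrib usq[symmetric] by simp
  qed simp
  let ?f = "fourier_inverse g"
  define h where "h k x = ?f x * gauss (x /\<^sub>R real (Suc k))" for k x
  have [measurable]: "(\<lambda>x::real^'n. gauss (x /\<^sub>R real (Suc k))) \<in> borel_measurable lebesgue" for k
    by (intro borel_measurable_lebesgue_continuous continuous_intros) auto
  have h[measurable]: "h k \<in> borel_measurable lebesgue" for k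
    unfolding h_def[abs_def] by measurable
  have h_int: "integrable lebesgue (h k)" for k
  proof -
    have "integrable lebesgue (\<lambda>x::real^'n. gauss (x /\<^sub>R real (Suc k)) * ?f x)"
      by (rule integrable_bounded_times[OF _ _ norm_fourier_inverse_le])
        (use integrable_shift_scale[OF _ integrable_gauss, of "real (Suc k)" 0] in auto)
    then show ?thesis unfolding h_def[abs_def] by (simp only: mult.commute)
  qed
  have hhat: "fourier_integral (h k) \<xi> = complex_of_real c * (LINT z|lebesgue. g (\<xi> + z /\<^sub>R real (Suc k)) * gauss z)" for k \<xi>
    unfolding h_def[abs_def] c_def by (rule fourier_integral_damped_inverse[OF g cont]) simp
  have gz[measurable]: "(\<lambda>z. g (\<xi> + z /\<^sub>R s) * gauss z) \<in> borel_measurable lebesgue" for \<xi> s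
    by (intro borel_measurable_lebesgue_continuous continuous_intros continuous_on_compose2[OF cont]) auto
  have hhat_lim: "(\<lambda>k. fourier_integral (h k) \<xi>) \<longlonglongrightarrow> g \<xi>" for \<xi>
  proof -
    have "(\<lambda>k. LINT z|lebesgue. g (\<xi> + z /\<^sub>R real (Suc k)) * gauss z) \<longlonglongrightarrow> (LINT z|lebesgue. g \<xi> * gauss (z :: real^'n))"
    proof (rule integral_dominated_convergence[of "\<lambda>z. g \<xi> * gauss z" lebesgue
          "\<lambda>k z. g (\<xi> + z /\<^sub>R real (Suc k)) * gauss z" "\<lambda>z. B * exp (R\<^sup>2 / 4) * u (1/8) \<xi> * u (1/4) z"])
      show "integrable lebesgue (\<lambda>z. B * exp (R\<^sup>2 / 4) * u (1/8) \<xi> * u (1/4) z)" using u by simp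
      show "AE z in lebesgue. cmod (g (\<xi> + z /\<^sub>R real (Suc k)) * gauss z) \<le> B * exp (R\<^sup>2 / 4) * u (1/8) \<xi> * u (1/4) z" for k
        using key by simp
      show "AE z in lebesgue. (\<lambda>k. g (\<xi> + z /\<^sub>R real (Suc k)) * gauss z) \<longlonglongrightarrow> g \<xi> * gauss z"
      proof (rule AE_I2)
        fix z :: "real^'n"
        have "(\<lambda>k. \<xi> + inverse (real (Suc k)) *\<^sub>R z) \<longlonglongrightarrow> \<xi> + 0 *\<^sub>R z"
          by (intro tendsto_intros LIMSEQ_inverse_real_of_nat)
        then have "(\<lambda>k. \<xi> + inverse (real (Suc k)) *\<^sub>R z) \<longlonglongrightarrow> \<xi>" by simp
        then show "(\<lambda>k. g (\<xi> + z /\<^sub>R real (Suc k)) * gauss z) \<longlonglongrightarrow> g \<xi> * gauss z"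
          by (intro tendsto_mult_right isCont_tendsto_compose[OF cont_at])
      qed
      show "(\<lambda>z. g \<xi> * gauss z) \<in> borel_measurable lebesgue"
        using borel_measurable_integrable[OF integrable_gauss] by (rule borel_measurable_times[OF borel_measurable_const])
    qed (rule gz)
    then have "(\<lambda>k. fourier_integral (h k) \<xi>) \<longlonglongrightarrow> complex_of_real c * (LINT z|lebesgue. g \<xi> * gauss (z :: real^'n))"
      unfolding hhat by (rule tendsto_mult_left)
    then show ?thesis
      using fourier_integral_gaussian_mass[where 'n = 'n]
      by (simp only: c_def integral_mult_right_zero mult.left_commute[of _ "g \<xi>"] mult_1_right)
  qed
  have hhat_le: "cmod (fourier_integral (h k) \<xi>) \<le> D * u (1/8) \<xi>" for k \<xi>
  proof -
    have "cmod (LINT z|lebesgue. g (\<xi> + z /\<^sub>R real (Suc k)) * gauss z)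
        \<le> (LINT z|lebesgue. B * exp (R\<^sup>2 / 4) * u (1/8) \<xi> * u (1/4) z)"
      by (rule norm_integral_le_dominating) (use u key in auto)
    then have "c * cmod (LINT z|lebesgue. g (\<xi> + z /\<^sub>R real (Suc k)) * gauss z)
        \<le> c * (B * exp (R\<^sup>2 / 4) * u (1/8) \<xi> * (LINT z|lebesgue. u (1/4) z))"
      using c by (intro mult_left_mono) auto
    then show ?thesis
      using c unfolding hhat norm_mult D_def by (simp add: mult_ac)
  qed
  have D: "D \<ge> 0" using order_trans[OF norm_ge_zero hhat_le[of 0 0]] by (simp add: u_def)
  have gD: "cmod (g \<xi>) \<le> D * u (1/8) \<xi>" for \<xi>
    by (rule Lim_bounded[OF tendsto_norm[OF hhat_lim]]) (use hhat_le in auto)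
  \<comment> \<open>The weighted integral of |f|^2 is the pairing of \<open>f\<close> with
    \<open>h k\<close>. By Parseval it is at most the L1 norm of \<open>g\<close> times
    \<open>D\<close>, uniformly in \<open>k\<close>, and Fatou's lemma removes the weight.\<close>
  have f2: "integrable lebesgue (\<lambda>x. (cmod (?f x))\<^sup>2)"
  proof (rule integrableI_bounded)
    define K where "K = (LINT \<xi>|lebesgue. cmod (g \<xi>)) * D"
    have bound: "(\<integral>\<^sup>+x. ennreal ((cmod (?f x))\<^sup>2 * exp (- (norm (x /\<^sub>R real (Suc k)))\<^sup>2 / 2)) \<partial>lebesgue) \<le> ennreal K" for k
    proof -
      have eq: "?f x * cnj (h k x) = complex_of_real ((cmod (?f x))\<^sup>2 * exp (- (norm (x /\<^sub>R real (Suc k)))\<^sup>2 / 2))" for x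
        unfolding h_def complex_cnj_mult complex_cnj_complex_of_real of_real_mult complex_norm_square by (simp only: mult.assoc)
      have "integrable lebesgue (\<lambda>x. cnj (h k x) * ?f x)"
        by (rule integrable_bounded_times[OF _ _ norm_fourier_inverse_le]) (use h_int in auto)
      then have "integrable lebesgue (\<lambda>x. ?f x * cnj (h k x))" by (simp only: mult.commute)
      then have i: "integrable lebesgue (\<lambda>x. (cmod (?f x))\<^sup>2 * exp (- (norm (x /\<^sub>R real (Suc k)))\<^sup>2 / 2))"
        unfolding eq complex_of_real_integrable_eq .
      have "(\<integral>\<^sup>+x. ennreal ((cmod (?f x))\<^sup>2 * exp (- (norm (x /\<^sub>R real (Suc k)))\<^sup>2 / 2)) \<partial>lebesgue)
         = ennreal (LINT x|lebesgue. (cmod (?f x))\<^sup>2 * exp (- (norm (x /\<^sub>R real (Suc k)))\<^sup>2 / 2))"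
        by (rule nn_integral_eq_integral[OF i]) simp
      also have "\<dots> = ennreal (cmod (LINT x|lebesgue. ?f x * cnj (h k x)))"
        unfolding eq integral_complex_of_real norm_of_real by (simp add: integral_nonneg_AE)
      also have "\<dots> = ennreal (cmod (LINT \<xi>|lebesgue. g \<xi> * cnj (fourier_integral (h k) \<xi>)))"
        by (simp only: fourier_parseval[OF g h_int])
      also have "\<dots> \<le> ennreal K"
      proof (rule ennreal_leI)
        have "cmod (LINT \<xi>|lebesgue. g \<xi> * cnj (fourier_integral (h k) \<xi>)) \<le> (LINT \<xi>|lebesgue. cmod (g \<xi>) * D)"
        proof (rule norm_integral_le_dominating)
          fix \<xi>
          have "cmod (fourier_integral (h k) \<xi>) \<le> D * 1"
            by (rule order_trans[OF hhat_le mult_left_mono]) (use D in \<open>auto simp: u_def\<close>)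
          then show "cmod (g \<xi> * cnj (fourier_integral (h k) \<xi>)) \<le> cmod (g \<xi>) * D"
            by (simp add: norm_mult mult_left_mono)
        qed (use g in auto)
        then show "cmod (LINT \<xi>|lebesgue. g \<xi> * cnj (fourier_integral (h k) \<xi>)) \<le> K" by (simp add: K_def)
      qed
      finally show ?thesis .
    qed
    have lim: "(\<lambda>k. ennreal ((cmod (?f x))\<^sup>2 * exp (- (norm (x /\<^sub>R real (Suc k)))\<^sup>2 / 2))) \<longlonglongrightarrow> ennreal (norm ((cmod (?f x))\<^sup>2))" for x
    proof -
      have "(\<lambda>k. (cmod (?f x))\<^sup>2 * exp (- (norm (inverse (real (Suc k)) *\<^sub>R x))\<^sup>2 / 2)) \<longlonglongrightarrow> (cmod (?f x))\<^sup>2 * exp (- (norm (0 *\<^sub>R x))\<^sup>2 / 2)"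
        by (intro tendsto_intros LIMSEQ_inverse_real_of_nat) simp
      then show ?thesis by (intro tendsto_ennrealI) simp
    qed
    have "(\<integral>\<^sup>+x. ennreal (norm ((cmod (?f x))\<^sup>2)) \<partial>lebesgue)
        = (\<integral>\<^sup>+x. liminf (\<lambda>k. ennreal ((cmod (?f x))\<^sup>2 * exp (- (norm (x /\<^sub>R real (Suc k)))\<^sup>2 / 2))) \<partial>lebesgue)"
      using lim_imp_Liminf[OF _ lim] by simp
    also have "\<dots> \<le> liminf (\<lambda>k. \<integral>\<^sup>+x. ennreal ((cmod (?f x))\<^sup>2 * exp (- (norm (x /\<^sub>R real (Suc k)))\<^sup>2 / 2)) \<partial>lebesgue)"
    proof (rule nn_integral_liminf)
      fix k
      have [measurable]: "(\<lambda>x::real^'n. exp (- (norm (x /\<^sub>R real (Suc k)))\<^sup>2 / 2)) \<in> borel_measurable lebesgue"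
        by (intro borel_measurable_lebesgue_continuous continuous_intros) auto
      show "(\<lambda>x. ennreal ((cmod (?f x))\<^sup>2 * exp (- (norm (x /\<^sub>R real (Suc k)))\<^sup>2 / 2))) \<in> borel_measurable lebesgue"
        by measurable
    qed
    also have "\<dots> \<le> limsup (\<lambda>k. \<integral>\<^sup>+x. ennreal ((cmod (?f x))\<^sup>2 * exp (- (norm (x /\<^sub>R real (Suc k)))\<^sup>2 / 2)) \<partial>lebesgue)"
      by (rule Liminf_le_Limsup) simp
    also have "\<dots> \<le> ennreal K" by (rule Limsup_bounded) (use bound in simp)
    finally show "(\<integral>\<^sup>+x. ennreal (norm ((cmod (?f x))\<^sup>2)) \<partial>lebesgue) < \<infinity>"
      by (rule le_less_trans) simp
  qed measurable
  have e1: "exp (- (norm (x :: real^'n))\<^sup>2 / 2) \<le> 1" for x by simp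
  show "is_fourier_L2 ?f g"
    unfolding is_fourier_L2_def
  proof (intro conjI exI[of _ h] allI)
    show "L2_function ?f" "L2_function g"
      using f2 g2 by (simp_all add: L2_function_def)
    show "integrable lebesgue (h k)" for k by (rule h_int)
    have hf: "(cmod (h k x))\<^sup>2 \<le> (cmod (?f x))\<^sup>2" for k x
      unfolding h_def norm_mult by (intro power_mono mult_left_le) auto
    then show "L2_function (h k)" for k
      unfolding L2_function_def by (intro conjI h Bochner_Integration.integrable_bound[OF f2]) auto
    have "(\<lambda>k. \<integral>\<^sup>+x. ennreal ((cmod (h k x - ?f x))\<^sup>2) \<partial>lebesgue) \<longlonglongrightarrow> (\<integral>\<^sup>+x. 0 \<partial>(lebesgue :: (real^'n) measure))"
    proof (rule nn_integral_dominated_convergence[where w = "\<lambda>x. ennreal ((cmod (?f x))\<^sup>2)"])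
      show "(\<integral>\<^sup>+x. ennreal ((cmod (?f x))\<^sup>2) \<partial>lebesgue) < \<infinity>"
        using f2 by (simp add: integrable_iff_bounded)
      show "AE x in lebesgue. ennreal ((cmod (h k x - ?f x))\<^sup>2) \<le> ennreal ((cmod (?f x))\<^sup>2)" for k
      proof (intro AE_I2 ennreal_leI power_mono)
        fix x
        have "h k x - ?f x = ?f x * complex_of_real (exp (- (norm (x /\<^sub>R real (Suc k)))\<^sup>2 / 2) - 1)"
          by (simp add: h_def algebra_simps)
        then have "cmod (h k x - ?f x) = cmod (?f x) * \<bar>exp (- (norm (x /\<^sub>R real (Suc k)))\<^sup>2 / 2) - 1\<bar>"
          by (simp only: norm_mult norm_of_real)
        then show "cmod (h k x - ?f x) \<le> cmod (?f x)"
          using e1[of "x /\<^sub>R real (Suc k)"] by (simp add: mult_left_le)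
      qed auto
      show "AE x in lebesgue. (\<lambda>k. ennreal ((cmod (h k x - ?f x))\<^sup>2)) \<longlonglongrightarrow> 0"
      proof (rule AE_I2)
        fix x
        have "(\<lambda>k. (cmod (?f x * complex_of_real (exp (- (norm (inverse (real (Suc k)) *\<^sub>R x))\<^sup>2 / 2)) - ?f x))\<^sup>2)
           \<longlonglongrightarrow> (cmod (?f x * complex_of_real (exp (- (norm (0 *\<^sub>R x))\<^sup>2 / 2)) - ?f x))\<^sup>2"
          by (intro tendsto_intros LIMSEQ_inverse_real_of_nat) simp
        then show "(\<lambda>k. ennreal ((cmod (h k x - ?f x))\<^sup>2)) \<longlonglongrightarrow> 0"
          unfolding h_def by (simp flip: ennreal_0)
      qed
    qed measurable
    then show "(\<lambda>k. \<integral>\<^sup>+x. ennreal ((cmod (h k x - ?f x))\<^sup>2) \<partial>lebesgue) \<longlonglongrightarrow> 0" by simp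
    \<comment> \<open>Both the transform of \<open>h k\<close> and its limit \<open>g\<close> are
      bounded by \<open>D * u (1/8)\<close>, so twice this bounds the difference; squaring doubles
      the rate of decay.\<close>
    have "(\<lambda>k. \<integral>\<^sup>+\<xi>. ennreal ((cmod (fourier_integral (h k) \<xi> - g \<xi>))\<^sup>2) \<partial>lebesgue) \<longlonglongrightarrow> (\<integral>\<^sup>+x. 0 \<partial>(lebesgue :: (real^'n) measure))"
    proof (rule nn_integral_dominated_convergence[where w = "\<lambda>\<xi>. ennreal ((2 * D)\<^sup>2 * u (2 * (1/8)) \<xi>)"])
      have "integrable lebesgue (\<lambda>\<xi>. (2 * D)\<^sup>2 * u (2 * (1/8)) \<xi>)" using u by simp
      moreover have "norm ((2 * D)\<^sup>2 * u (2 * (1/8)) \<xi>) = (2 * D)\<^sup>2 * u (2 * (1/8)) \<xi>" for \<xi> by (simp add: u_def)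
      ultimately show "(\<integral>\<^sup>+\<xi>. ennreal ((2 * D)\<^sup>2 * u (2 * (1/8)) \<xi>) \<partial>lebesgue) < \<infinity>"
        unfolding integrable_iff_bounded by simp
      show "AE \<xi> in lebesgue. ennreal ((cmod (fourier_integral (h k) \<xi> - g \<xi>))\<^sup>2) \<le> ennreal ((2 * D)\<^sup>2 * u (2 * (1/8)) \<xi>)" for k
      proof (intro AE_I2 ennreal_leI)
        fix \<xi>
        have "cmod (fourier_integral (h k) \<xi> - g \<xi>) \<le> 2 * D * u (1/8) \<xi>"
          using norm_triangle_ineq4[of "fourier_integral (h k) \<xi>" "g \<xi>"] hhat_le[of k \<xi>] gD[of \<xi>] by linarith
        then show "(cmod (fourier_integral (h k) \<xi> - g \<xi>))\<^sup>2 \<le> (2 * D)\<^sup>2 * u (2 * (1/8)) \<xi>"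
          unfolding usq[symmetric] power_mult_distrib[symmetric] by (intro power_mono) auto
      qed
      show "AE \<xi> in lebesgue. (\<lambda>k. ennreal ((cmod (fourier_integral (h k) \<xi> - g \<xi>))\<^sup>2)) \<longlonglongrightarrow> 0"
      proof (rule AE_I2)
        fix \<xi>
        have "(\<lambda>k. (cmod (fourier_integral (h k) \<xi> - g \<xi>))\<^sup>2) \<longlonglongrightarrow> (cmod (g \<xi> - g \<xi>))\<^sup>2"
          by (intro tendsto_intros hhat_lim)
        then show "(\<lambda>k. ennreal ((cmod (fourier_integral (h k) \<xi> - g \<xi>))\<^sup>2)) \<longlonglongrightarrow> 0"
          by (simp flip: ennreal_0)
      qed
    qed (use u in measurable)
    then show "(\<lambda>k. \<integral>\<^sup>+\<xi>. ennreal ((cmod (fourier_integral (h k) \<xi> - g \<xi>))\<^sup>2) \<partial>lebesgue) \<longlonglongrightarrow> 0" by simp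
  qed
qed

subsection \<open>The Macdonald function and logarithmic derivatives\<close>

text \<open>Up to the sign (-1)^m, the m-th derivative of K_\<nu> at positive \<open>x\<close>: each
  derivative of exp(-x cosh s) in \<open>x\<close> brings down -cosh s.\<close>

definition bessel_moment :: "real \<Rightarrow> nat \<Rightarrow> real \<Rightarrow> real" where
  "bessel_moment \<nu> m x = (LINT s|lborel. indicator {0..} s * (exp (- x * cosh s) * cosh (\<nu> * s) * cosh s ^ m))"

lemma bessel_K_eq_moment: "bessel_K \<nu> x = bessel_moment \<nu> 0 x"
  by (simp add: bessel_K_def bessel_moment_def set_lebesgue_integral_def)

lemma power_div_fact_le_exp: "y ^ N / fact N \<le> exp y" if "y \<ge> 0" for y :: real
proof -
  have "(\<Sum>n\<in>{N}. y ^ n / fact n) \<le> exp y"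
    using sum_le_suminf[OF summable_exp_generic[of y], of "{N}"] that
    by (simp add: exp_def divide_inverse mult.commute)
  then show ?thesis by simp
qed

lemma integrable_bessel_moment:
  fixes \<nu> x :: real
  assumes "x > 0"
  shows "integrable lborel (\<lambda>s. indicator {0..} s * (exp (- x * cosh s) * cosh (\<nu> * s) * cosh s ^ m))"
proof -
  \<comment> \<open>For s \<ge> 0 the growing factors are at most exp((N - 1) s), and the extra 1
    leaves exp(-s) as majorant. \<open>B\<close> comes from y^N / N! \<le> exp y at y = x exp(s) /
    2, which lets exp(-x cosh s) absorb exp(N s).\<close>
  define N where "N = nat \<lceil>\<bar>\<nu>\<bar>\<rceil> + m + 1"
  define B where "B = fact N * (2 / x) ^ N"
  have key: "exp (- x * cosh s) * cosh (\<nu> * s) * cosh s ^ m \<le> B * exp (- s)" if "s \<ge> 0" for s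
  proof -
    have c: "cosh z \<le> exp \<bar>z\<bar>" for z :: real
    proof -
      have "exp z \<le> exp \<bar>z\<bar>" "exp (- z) \<le> exp \<bar>z\<bar>" by simp_all
      from add_mono[OF this] show ?thesis by (simp add: cosh_field_def)
    qed
    have c2: "exp s / 2 \<le> cosh s" by (simp add: cosh_field_def field_simps)
    have "(x * exp s / 2) ^ N / fact N \<le> exp (x * exp s / 2)"
      by (rule power_div_fact_le_exp) (use assms in simp)
    then have "exp s ^ N \<le> B * exp (x * exp s / 2)"
      using assms by (simp add: B_def field_simps power_mult_distrib)
    then have 1: "exp s ^ N * exp (- (x * exp s / 2)) \<le> B"
      by (simp add: exp_minus field_simps)
    have 2: "exp (- x * cosh s) \<le> exp (- (x * exp s / 2))"
      using mult_left_mono[OF c2, of x] assms by simp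
    have "\<bar>\<nu>\<bar> * s \<le> real (nat \<lceil>\<bar>\<nu>\<bar>\<rceil>) * s"
      using that by (intro mult_right_mono) linarith+
    then have "cosh (\<nu> * s) \<le> exp (real (nat \<lceil>\<bar>\<nu>\<bar>\<rceil>) * s)"
      using c[of "\<nu> * s"] that by (auto simp: abs_mult intro: order_trans)
    moreover have "cosh s ^ m \<le> exp (real m * s)"
      using power_mono[OF c[of s], of m] that by (simp add: exp_of_nat_mult)
    ultimately have "cosh (\<nu> * s) * cosh s ^ m \<le> exp (real (nat \<lceil>\<bar>\<nu>\<bar>\<rceil>) * s) * exp (real m * s)"
      by (intro mult_mono) (auto simp: cosh_real_nonneg)
    also have "\<dots> = exp s ^ N * exp (- s)"
      unfolding exp_of_nat_mult[symmetric] exp_add[symmetric] N_def by (simp add: algebra_simps)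
    finally have 3: "cosh (\<nu> * s) * cosh s ^ m \<le> exp s ^ N * exp (- s)" .
    have "exp (- x * cosh s) * (cosh (\<nu> * s) * cosh s ^ m) \<le> exp (- (x * exp s / 2)) * (exp s ^ N * exp (- s))"
      by (rule mult_mono[OF 2 3]) (auto simp: cosh_real_nonneg)
    also have "\<dots> = (exp s ^ N * exp (- (x * exp s / 2))) * exp (- s)" by simp
    also have "\<dots> \<le> B * exp (- s)" by (rule mult_right_mono[OF 1]) simp
    finally show ?thesis by (simp only: mult.assoc)
  qed
  have "integrable lborel (\<lambda>s::real. s ^ 0 * exp (- s) * indicator {0..} s)"
    using nn_intergal_power_times_exp_Ici[of 0]
    by (intro integrableI_nonneg) (auto simp: mult_ac ennreal_mult ennreal_indicator)
  then have i: "integrable lborel (\<lambda>s::real. B * (indicator {0..} s * exp (- s)))"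
    by (simp add: mult.commute)
  have "B \<ge> 0" using assms by (simp add: B_def)
  show ?thesis
  proof (rule Bochner_Integration.integrable_bound[OF i])
    have [measurable]: "cosh \<in> borel_measurable (borel :: real measure)"
      by (intro borel_measurable_continuous_onI continuous_intros)
    show "(\<lambda>s. indicator {0..} s * (exp (- x * cosh s) * cosh (\<nu> * s) * cosh s ^ m)) \<in> borel_measurable lborel"
      by measurable
    show "AE s in lborel. norm (indicator {0..} s * (exp (- x * cosh s) * cosh (\<nu> * s) * cosh s ^ m))
        \<le> norm (B * (indicator {0..} s * exp (- s)))"
      using key assms \<open>B \<ge> 0\<close> by (intro AE_I2) (auto simp: indicator_def cosh_real_nonneg abs_mult)
  qed
qed

lemma bessel_moment_nonneg: "bessel_moment \<nu> m x \<ge> 0"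
  unfolding bessel_moment_def by (intro Bochner_Integration.integral_nonneg) (auto simp: cosh_real_nonneg)

lemma bessel_moment_antimono:
  assumes "0 < a" "a \<le> x" shows "bessel_moment \<nu> m x \<le> bessel_moment \<nu> m a"
  unfolding bessel_moment_def
proof (intro integral_mono integrable_bessel_moment)
  fix s
  have "exp (- x * cosh s) \<le> exp (- a * cosh s)"
    using assms by (simp add: mult_right_mono cosh_real_nonneg)
  then show "indicator {0..} s * (exp (- x * cosh s) * cosh (\<nu> * s) * cosh s ^ m)
      \<le> indicator {0..} s * (exp (- a * cosh s) * cosh (\<nu> * s) * cosh s ^ m)"
    by (intro mult_left_mono mult_right_mono) (auto simp: cosh_real_nonneg)
qed (use assms in auto)

text \<open>A nonnegative integrand with zero integral vanishes almost everywhere, but this one is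
  positive on the unit interval.\<close>

lemma bessel_moment_pos:
  assumes "x > 0" shows "bessel_moment \<nu> m x > 0"
proof (rule ccontr)
  let ?F = "\<lambda>s. indicator {0..} s * (exp (- x * cosh s) * cosh (\<nu> * s) * cosh s ^ m)"
  assume "\<not> bessel_moment \<nu> m x > 0"
  then have "integral\<^sup>L lborel ?F = 0"
    using bessel_moment_nonneg[of \<nu> m x] unfolding bessel_moment_def by linarith
  then have "AE s in lborel. ?F s = 0"
    using integral_nonneg_eq_0_iff_AE[OF integrable_bessel_moment[OF assms]] by (auto simp: cosh_real_nonneg)
  then have "AE s in lborel. s \<notin> {0<..<1::real}"
    by eventually_elim (auto simp: indicator_def cosh_real_pos less_imp_neq[symmetric])
  then have "emeasure lborel {0<..<1::real} = 0"
    by (subst AE_iff_measurable[symmetric]) auto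
  then show False by simp
qed

lemma bessel_moment_has_derivative:
  assumes "x > 0"
  shows "(bessel_moment \<nu> m has_real_derivative - bessel_moment \<nu> (Suc m) x) (at x)"
proof -
  let ?f = "\<lambda>m x s. indicator {0..} s * (exp (- x * cosh s) * cosh (\<nu> * s) * cosh s ^ m) :: real"
  have pos: "y > 0" if "y \<in> ball x (x / 2)" for y
    using that assms by (auto simp: dist_real_def abs_real_def split: if_splits)
  \<comment> \<open>Radius x/2 keeps the argument at least x/2, where the integrand of the next
    moment at x/2 dominates.\<close>
  have "((\<lambda>y. LINT s|lborel. ?f m y s) has_vector_derivative (LINT s|lborel. - ?f (Suc m) x s)) (at x)"
  proof (rule has_vector_derivative_lebesgue_integral[where \<delta> = "x / 2" and G = "?f (Suc m) (x / 2)"])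
    show "integrable lborel (?f m y)" if "y \<in> ball x (x / 2)" for y
      by (rule integrable_bessel_moment[OF pos[OF that]])
    show "((\<lambda>y. ?f m y s) has_vector_derivative - ?f (Suc m) y s) (at y)" for y s
      unfolding has_real_derivative_iff_has_vector_derivative[symmetric]
      by (auto intro!: derivative_eq_intros simp: algebra_simps)
    show "norm (- ?f (Suc m) y s) \<le> ?f (Suc m) (x / 2) s" if "y \<in> ball x (x / 2)" for y s
    proof -
      have "x / 2 \<le> y" using that assms by (auto simp: dist_real_def abs_real_def split: if_splits)
      then have "exp (- y * cosh s) \<le> exp (- (x / 2) * cosh s)"
        using mult_right_mono[of "x / 2" y "cosh s"] by (simp add: cosh_real_nonneg)
      then show ?thesis
        using cosh_real_nonneg[of "\<nu> * s"] cosh_real_nonneg[of s]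
        by (auto simp: indicator_def abs_mult intro!: mult_right_mono)
    qed
    show "integrable lborel (?f (Suc m) (x / 2))"
      by (rule integrable_bessel_moment) (use assms in simp)
  qed (use assms in simp)
  then show ?thesis
    unfolding has_real_derivative_iff_has_vector_derivative bessel_moment_def[abs_def] by simp
qed

lemma borel_measurable_bessel_moment [measurable]: "bessel_moment \<nu> m \<in> borel_measurable borel"
proof -
  have [measurable]: "cosh \<in> borel_measurable (borel :: real measure)"
    by (intro borel_measurable_continuous_onI continuous_intros)
  have "(\<lambda>(x, s). indicator {0..} s * (exp (- x * cosh s) * cosh (\<nu> * s) * cosh s ^ m)) \<in> borel_measurable (borel \<Otimes>\<^sub>M lborel)"
    by measurable
  then show ?thesis
    unfolding bessel_moment_def[abs_def] by (rule lborel.borel_measurable_lebesgue_integral)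
qed

section \<open>Derivatives of log |u|^2 along a real variable\<close>

text \<open>Locally log |u|^2 is 2 Re (log u), hence the formulas. The computation goes through real
  and imaginary parts and so involves no branch of the logarithm.\<close>

lemma
  fixes u u1 :: "real \<Rightarrow> complex"
  assumes S: "open S" "a \<in> S" and u: "\<And>s. s \<in> S \<Longrightarrow> (u has_vector_derivative u1 s) (at s)"
    and u1: "(u1 has_vector_derivative u2) (at a)" and ne: "u a \<noteq> 0"
    and F: "\<And>s. s \<in> S \<Longrightarrow> F s = ln ((cmod (u s))\<^sup>2)"
  shows deriv_ln_cmod2: "deriv F a = 2 * Re (u1 a / u a)" (is ?A)
    and deriv2_ln_cmod2: "(deriv ^^ 2) F a = 2 * Re (u2 / u a - (u1 a / u a)\<^sup>2)" (is ?B)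
proof -
  \<comment> \<open>The first-derivative formula must hold on a whole neighbourhood of
    \<open>a\<close> before it can be differentiated there, so the zeros of \<open>u\<close> are
    removed.\<close>
  define S' where "S' = S \<inter> u -` (- {0})"
  have "continuous_on S u"
    by (intro continuous_at_imp_continuous_on ballI) (use u has_vector_derivative_continuous in blast)
  then have S': "open S'" "a \<in> S'" "S' \<subseteq> S"
    unfolding S'_def using S ne continuous_open_preimage[of S u "- {0}"] by auto
  have der: "(F has_real_derivative 2 * Re (u1 s / u s)) (at s)" if "s \<in> S'" for s
  proof -
    have us: "u s \<noteq> 0" "s \<in> S" using that by (auto simp: S'_def)
    have R: "((\<lambda>s. Re (u s)) has_real_derivative Re (u1 s)) (at s)" "((\<lambda>s. Im (u s)) has_real_derivative Im (u1 s)) (at s)"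
      unfolding has_real_derivative_iff_has_vector_derivative
      using bounded_linear.has_vector_derivative[OF bounded_linear_Re u[OF us(2)]]
        bounded_linear.has_vector_derivative[OF bounded_linear_Im u[OF us(2)]] by simp_all
    have pos: "(Re (u s))\<^sup>2 + (Im (u s))\<^sup>2 > 0" using us(1) by (simp add: complex_neq_0)
    have "((\<lambda>s. ln ((Re (u s))\<^sup>2 + (Im (u s))\<^sup>2)) has_real_derivative
        (2 * Re (u s) * Re (u1 s) + 2 * Im (u s) * Im (u1 s)) / ((Re (u s))\<^sup>2 + (Im (u s))\<^sup>2)) (at s)"
      by (rule DERIV_cong[OF DERIV_ln_divide[THEN DERIV_chain2, OF pos
            DERIV_add[OF DERIV_power[OF R(1), of 2] DERIV_power[OF R(2), of 2]]]]) simp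
    moreover have "(2 * Re (u s) * Re (u1 s) + 2 * Im (u s) * Im (u1 s)) / ((Re (u s))\<^sup>2 + (Im (u s))\<^sup>2) = 2 * Re (u1 s / u s)"
      unfolding Re_divide by (simp add: add_divide_distrib mult_ac)
    ultimately have "((\<lambda>s. ln ((cmod (u s))\<^sup>2)) has_real_derivative 2 * Re (u1 s / u s)) (at s)"
      by (simp add: cmod_power2)
    then show ?thesis
      by (rule has_field_derivative_transform_within_open[OF _ S(1) us(2)]) (simp add: F)
  qed
  show ?A by (rule DERIV_imp_deriv[OF der[OF S'(2)]])
  have "((\<lambda>s. u1 s / u s) has_vector_derivative (u2 / u a - (u1 a / u a)\<^sup>2)) (at a)"
    using u1 u[OF S(2)] ne unfolding has_vector_derivative_def
    by (auto intro!: derivative_eq_intros simp: fun_eq_iff field_simps power2_eq_square scaleR_conv_of_real)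
  then have "((\<lambda>s. 2 * Re (u1 s / u s)) has_real_derivative 2 * Re (u2 / u a - (u1 a / u a)\<^sup>2)) (at a)"
    unfolding has_real_derivative_iff_has_vector_derivative
    by (intro has_vector_derivative_mult_right bounded_linear.has_vector_derivative[OF bounded_linear_Re])
  then have "(deriv F has_real_derivative 2 * Re (u2 / u a - (u1 a / u a)\<^sup>2)) (at a)"
    by (rule has_field_derivative_transform_within_open[OF _ S'(1,2)]) (simp add: DERIV_imp_deriv[OF der])
  then show ?B by (simp add: numeral_2_eq_2 DERIV_imp_deriv)
qed

subsection \<open>Bessel wave packets\<close>

definition wave :: "(real^'n \<Rightarrow> complex) \<Rightarrow> real^'n \<Rightarrow> complex" where
  "wave q y = (LINT \<xi>|lebesgue. q \<xi> * iexp (y \<bullet> \<xi>))"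

text \<open>The Fourier multiplier of the derivative along \<open>b\<close>: derivatives of waves in
  \<open>y\<close> are again waves and the rule can be iterated.\<close>

abbreviation deriv_symbol :: "real^'n \<Rightarrow> (real^'n \<Rightarrow> complex) \<Rightarrow> real^'n \<Rightarrow> complex" where
  "deriv_symbol b q \<xi> \<equiv> \<i> * complex_of_real (b \<bullet> \<xi>) * q \<xi>"

lemma norm_deriv_symbol_le:
  assumes "q \<xi> \<noteq> 0 \<Longrightarrow> norm \<xi> \<le> R"
  shows "norm (deriv_symbol b q \<xi>) \<le> norm (q \<xi>) * (norm b * R)"
proof (cases "q \<xi> = 0")
  case False
  have "\<bar>b \<bullet> \<xi>\<bar> \<le> norm b * R"
    using Cauchy_Schwarz_ineq2[of b \<xi>] mult_left_mono[OF assms[OF False], of "norm b"] by simp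
  then show ?thesis
    using mult_left_mono[of "\<bar>b \<bullet> \<xi>\<bar>" "norm b * R" "norm (q \<xi>)"] by (simp add: norm_mult mult.commute)
qed simp

lemma integrable_deriv_symbol:
  assumes q: "integrable lebesgue q" and supp: "\<And>\<xi>. q \<xi> \<noteq> 0 \<Longrightarrow> norm \<xi> \<le> R"
  shows "integrable lebesgue (deriv_symbol b q)"
proof (rule Bochner_Integration.integrable_bound)
  show "integrable lebesgue (\<lambda>\<xi>. norm (q \<xi>) * (norm b * R))" using q by simp
  have [measurable]: "q \<in> borel_measurable lebesgue" using q by simp
  show "deriv_symbol b q \<in> borel_measurable lebesgue" by measurable
  show "AE \<xi> in lebesgue. norm (deriv_symbol b q \<xi>) \<le> norm (norm (q \<xi>) * (norm b * R))"
    using order_trans[OF norm_deriv_symbol_le[OF supp] abs_ge_self] by simp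
qed

lemma integrable_wave: "integrable lebesgue q \<Longrightarrow> integrable lebesgue (\<lambda>\<xi>. q \<xi> * iexp (y \<bullet> \<xi>))"
  by (rule integrable_bounded_times[of _ _ _ 1]) auto

lemma wave_has_vector_derivative:
  assumes q: "integrable lebesgue q" and supp: "\<And>\<xi>. q \<xi> \<noteq> 0 \<Longrightarrow> norm \<xi> \<le> R"
  shows "((\<lambda>s. wave q (y + s *\<^sub>R b)) has_vector_derivative wave (deriv_symbol b q) (y + t *\<^sub>R b)) (at t)"
  unfolding wave_def
proof (rule has_vector_derivative_lebesgue_integral[where \<delta> = 1 and G = "\<lambda>\<xi>. norm (q \<xi>) * (norm b * R)"
      and f' = "\<lambda>t \<xi>. deriv_symbol b q \<xi> * iexp ((y + t *\<^sub>R b) \<bullet> \<xi>)"])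
  show "integrable lebesgue (\<lambda>\<xi>. q \<xi> * iexp ((y + s *\<^sub>R b) \<bullet> \<xi>))" for s
    by (rule integrable_wave[OF q])
  show "integrable lebesgue (\<lambda>\<xi>. norm (q \<xi>) * (norm b * R))" using q by simp
  show "norm (deriv_symbol b q \<xi> * iexp ((y + s *\<^sub>R b) \<bullet> \<xi>)) \<le> norm (q \<xi>) * (norm b * R)" for s \<xi>
  proof -
    have "norm (deriv_symbol b q \<xi>) \<le> norm (q \<xi>) * (norm b * R)"
      by (rule norm_deriv_symbol_le) (rule supp)
    then show ?thesis by (simp only: norm_mult norm_exp_i_times mult_1_right)
  qed
  show "((\<lambda>s. q \<xi> * iexp ((y + s *\<^sub>R b) \<bullet> \<xi>)) has_vector_derivative
      deriv_symbol b q \<xi> * iexp ((y + s *\<^sub>R b) \<bullet> \<xi>)) (at s)" for s \<xi>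
  proof -
    have eq: "iexp ((y + s *\<^sub>R b) \<bullet> \<xi>) = exp (\<i> * (complex_of_real (y \<bullet> \<xi>) + complex_of_real s * complex_of_real (b \<bullet> \<xi>)))" for s
      by (simp only: inner_add_left inner_scaleR_left of_real_add of_real_mult)
    have "((\<lambda>z. q \<xi> * exp (\<i> * (complex_of_real (y \<bullet> \<xi>) + z * complex_of_real (b \<bullet> \<xi>)))) has_field_derivative
        deriv_symbol b q \<xi> * exp (\<i> * (complex_of_real (y \<bullet> \<xi>) + z * complex_of_real (b \<bullet> \<xi>)))) (at z)" for z
      by (auto intro!: derivative_eq_intros simp: algebra_simps)
    from has_vector_derivative_real_field[OF this] show ?thesis unfolding eq .
  qed
qed simp

text \<open>The lower bound \<open>a\<close> keeps the Bessel argument away from the singularity at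
  0; the upper bound \<open>R\<close> controls the multipliers produced by differentiation.\<close>

locale bessel_packet =
  fixes \<phi> :: "real^'n \<Rightarrow> real" and a R \<beta> \<nu> :: real
  assumes \<phi>_borel [measurable]: "\<phi> \<in> borel_measurable borel"
    and \<phi>_int: "integrable lebesgue (\<lambda>\<xi>. complex_of_real (\<phi> \<xi>))"
    and a: "a > 0" and \<beta>: "\<beta> \<ge> 0"
    and supp: "\<And>\<xi>. \<phi> \<xi> \<noteq> 0 \<Longrightarrow> a \<le> norm \<xi>" "\<And>\<xi>. \<phi> \<xi> \<noteq> 0 \<Longrightarrow> norm \<xi> \<le> R"
begin

text \<open>For t > 0 this is the m-th \<open>t\<close>-derivative of the amplitude: the chain rule
  gives |\<xi>|^m, and the sign comes from the derivatives of the Bessel moments.\<close>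

definition amp :: "nat \<Rightarrow> real \<Rightarrow> real^'n \<Rightarrow> complex" where
  "amp m t \<xi> = complex_of_real (\<phi> \<xi> * norm \<xi> powr \<beta> * (- norm \<xi>) ^ m * bessel_moment \<nu> m (t * norm \<xi>))"

lemma borel_measurable_amp [measurable]: "amp m t \<in> borel_measurable borel"
  unfolding amp_def[abs_def] by measurable

lemma amp_supp: "amp m t \<xi> \<noteq> 0 \<Longrightarrow> norm \<xi> \<le> R"
  using supp(2)[of \<xi>] by (auto simp: amp_def)

text \<open>On the support the decreasing moment is largest at \<open>t0 * a\<close> and the powers
  of |\<xi>| at \<open>R\<close>. The bound is uniform in t \<ge> t0, as domination
  requires.\<close>

lemma norm_amp_le:
  assumes "0 < t0" "t0 \<le> t"
  shows "norm (amp m t \<xi>) \<le> norm (complex_of_real (\<phi> \<xi>)) * (R powr \<beta> * R ^ m * bessel_moment \<nu> m (t0 * a))"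
proof (cases "\<phi> \<xi> = 0")
  case False
  then have 1: "a \<le> norm \<xi>" "norm \<xi> \<le> R" using supp by auto
  have "t0 * a \<le> t * norm \<xi>" using 1 a assms by (intro mult_mono) auto
  then have "bessel_moment \<nu> m (t * norm \<xi>) \<le> bessel_moment \<nu> m (t0 * a)"
    using a assms by (intro bessel_moment_antimono) auto
  then have "norm \<xi> powr \<beta> * norm \<xi> ^ m * bessel_moment \<nu> m (t * norm \<xi>) \<le> R powr \<beta> * R ^ m * bessel_moment \<nu> m (t0 * a)"
    using 1 a \<beta> by (intro mult_mono power_mono powr_mono2 bessel_moment_nonneg mult_nonneg_nonneg) auto
  from mult_left_mono[OF this, of "\<bar>\<phi> \<xi>\<bar>"] show ?thesis
    unfolding amp_def norm_of_real by (simp add: abs_mult power_abs mult.assoc abs_of_nonneg[OF bessel_moment_nonneg])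
qed (simp add: amp_def)

lemma integrable_amp:
  assumes "t > 0" shows "integrable lebesgue (amp m t)"
proof (rule Bochner_Integration.integrable_bound)
  show "integrable lebesgue (\<lambda>\<xi>. norm (complex_of_real (\<phi> \<xi>)) * (R powr \<beta> * R ^ m * bessel_moment \<nu> m (t * a)))"
    by (intro integrable_mult_left integrable_norm \<phi>_int)
  show "amp m t \<in> borel_measurable lebesgue" by (rule measurable_completion) measurable
  show "AE \<xi> in lebesgue. norm (amp m t \<xi>) \<le> norm (norm (complex_of_real (\<phi> \<xi>)) * (R powr \<beta> * R ^ m * bessel_moment \<nu> m (t * a)))"
    using order_trans[OF norm_amp_le[OF assms order_refl] abs_ge_self] unfolding real_norm_def by (rule AE_I2)
qed

lemma wave_amp_has_vector_derivative:
  assumes "t > 0"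
  shows "((\<lambda>s. wave (amp m s) y) has_vector_derivative wave (amp (Suc m) t) y) (at t)"
  unfolding wave_def
proof (rule has_vector_derivative_lebesgue_integral[where \<delta> = "t / 2"
      and G = "\<lambda>\<xi>. norm (complex_of_real (\<phi> \<xi>)) * (R powr \<beta> * R ^ (Suc m) * bessel_moment \<nu> (Suc m) (t / 2 * a))"
      and f' = "\<lambda>t \<xi>. amp (Suc m) t \<xi> * iexp (y \<bullet> \<xi>)"])
  have s: "0 < s" "t / 2 \<le> s" if "s \<in> ball t (t / 2)" for s
    using that assms by (auto simp: dist_real_def abs_real_def split: if_splits)
  show "integrable lebesgue (\<lambda>\<xi>. amp m s \<xi> * iexp (y \<bullet> \<xi>))" if "s \<in> ball t (t / 2)" for s
    by (rule integrable_wave[OF integrable_amp[OF s(1)[OF that]]])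
  show "integrable lebesgue (\<lambda>\<xi>. norm (complex_of_real (\<phi> \<xi>)) * (R powr \<beta> * R ^ (Suc m) * bessel_moment \<nu> (Suc m) (t / 2 * a)))"
    by (intro integrable_mult_left integrable_norm \<phi>_int)
  show "norm (amp (Suc m) s \<xi> * iexp (y \<bullet> \<xi>)) \<le> norm (complex_of_real (\<phi> \<xi>)) * (R powr \<beta> * R ^ (Suc m) * bessel_moment \<nu> (Suc m) (t / 2 * a))"
    if "s \<in> ball t (t / 2)" for s \<xi>
    using norm_amp_le[OF _ s(2)[OF that], of "Suc m" \<xi>] assms by (simp only: norm_mult norm_exp_i_times) simp
  show "((\<lambda>s. amp m s \<xi> * iexp (y \<bullet> \<xi>)) has_vector_derivative amp (Suc m) s \<xi> * iexp (y \<bullet> \<xi>)) (at s)"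
    if "s \<in> ball t (t / 2)" for s \<xi>
  proof (cases "\<phi> \<xi> = 0")
    case False
    then have "norm \<xi> > 0" using supp(1)[OF False] a by linarith
    then have "s * norm \<xi> > 0" using s(1)[OF that] by (rule mult_pos_pos[rotated])
    note d = DERIV_chain2[OF bessel_moment_has_derivative[OF this, of \<nu> m] DERIV_cmult_right[OF DERIV_ident, of "norm \<xi>"]]
    have "((\<lambda>s. \<phi> \<xi> * norm \<xi> powr \<beta> * (- norm \<xi>) ^ m * bessel_moment \<nu> m (s * norm \<xi>)) has_real_derivative
        \<phi> \<xi> * norm \<xi> powr \<beta> * (- norm \<xi>) ^ (Suc m) * bessel_moment \<nu> (Suc m) (s * norm \<xi>)) (at s)"
      by (rule DERIV_cong[OF DERIV_cmult[OF d]]) simp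
    from has_vector_derivative_mult_left[OF has_vector_derivative_of_real[OF this]]
    show ?thesis unfolding amp_def .
  qed (simp add: amp_def)
qed (use assms in simp)

definition packet :: "complex \<Rightarrow> real \<Rightarrow> real^'n \<Rightarrow> real \<Rightarrow> complex" where
  "packet \<kappa> p y t = \<kappa> * complex_of_real (t powr p) * wave (amp 0 t) y"

text \<open>At t = 1 all powers of \<open>t\<close> equal 1. The constant \<open>\<kappa>\<close>
  cancels in logarithmic derivatives, and the terms with \<open>p\<close> come from the product rule
  for t^p.\<close>

lemma hyp_laplacian_ln_packet:
  fixes y :: "real^'n"
  defines "v \<equiv> wave (amp 0 1) y" and "v1 \<equiv> wave (amp 1 1) y" and "v2 \<equiv> wave (amp 2 1) y"
  assumes F: "\<And>y t. t > 0 \<Longrightarrow> F y t = ln ((cmod (packet \<kappa> p y t))\<^sup>2)" and "\<kappa> \<noteq> 0" and v: "v \<noteq> 0"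
  shows "hyp_laplacian F y 1 =
    (\<Sum>i\<in>UNIV. 2 * Re (wave (deriv_symbol (axis i 1) (deriv_symbol (axis i 1) (amp 0 1))) y / v
        - (wave (deriv_symbol (axis i 1) (amp 0 1)) y / v)\<^sup>2))
    + 2 * Re (complex_of_real (p * (p - 1)) + 2 * complex_of_real p * (v1 / v) + v2 / v - (complex_of_real p + v1 / v)\<^sup>2)
    - (real CARD('n) - 1) * (2 * Re (complex_of_real p + v1 / v))"
proof -
  have "(deriv ^^ 2) (\<lambda>s. F (y + s *\<^sub>R axis i 1) 1) 0 =
      2 * Re (wave (deriv_symbol (axis i 1) (deriv_symbol (axis i 1) (amp 0 1))) y / v
        - (wave (deriv_symbol (axis i 1) (amp 0 1)) y / v)\<^sup>2)" for i
  proof -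
    let ?b = "axis i 1 :: real^'n"
    note i0 = integrable_amp[of 1 0, OF zero_less_one]
    have supp2: "deriv_symbol ?b (amp 0 1) \<xi> \<noteq> 0 \<Longrightarrow> norm \<xi> \<le> R" for \<xi>
      using amp_supp[of 0 1 \<xi>] by auto
    have d1: "((\<lambda>s. \<kappa> * wave (amp 0 1) (y + s *\<^sub>R ?b)) has_vector_derivative
        \<kappa> * wave (deriv_symbol ?b (amp 0 1)) (y + s *\<^sub>R ?b)) (at s)" for s
      by (intro has_vector_derivative_mult_right wave_has_vector_derivative[OF i0 amp_supp])
    have d2: "((\<lambda>s. \<kappa> * wave (deriv_symbol ?b (amp 0 1)) (y + s *\<^sub>R ?b)) has_vector_derivative
        \<kappa> * wave (deriv_symbol ?b (deriv_symbol ?b (amp 0 1))) (y + 0 *\<^sub>R ?b)) (at 0)"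
      by (intro has_vector_derivative_mult_right wave_has_vector_derivative[OF integrable_deriv_symbol[OF i0 amp_supp] supp2])
    show ?thesis
      using deriv2_ln_cmod2[OF open_UNIV UNIV_I d1 d2, of "\<lambda>s. F (y + s *\<^sub>R ?b) 1"] v \<open>\<kappa> \<noteq> 0\<close>
      by (simp add: F packet_def v_def)
  qed
  moreover
  define u u1 where "u t = packet \<kappa> p y t" and
    "u1 t = \<kappa> * (complex_of_real (t powr p) * wave (amp 1 t) y + complex_of_real (p * t powr (p - 1)) * wave (amp 0 t) y)" for t
  have pow: "((\<lambda>t. complex_of_real (c * t powr r)) has_vector_derivative complex_of_real (c * (r * t powr (r - 1)))) (at t)"
    if "t > 0" for c r t :: real
    using has_vector_derivative_of_real[OF DERIV_cmult[OF has_real_derivative_powr[OF that, of r], of c]]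
    by simp
  have d1: "(u has_vector_derivative u1 t) (at t)" if "t \<in> {0<..}" for t
  proof -
    have "t > 0" using that by simp
    from has_vector_derivative_mult_right[OF has_vector_derivative_mult[OF pow[OF this, of 1 p] wave_amp_has_vector_derivative[OF this, of 0 y]], of \<kappa>]
    show ?thesis by (simp add: u_def[abs_def] u1_def packet_def mult.assoc)
  qed
  have d2: "(u1 has_vector_derivative \<kappa> * (v2 + complex_of_real p * v1 + (complex_of_real p * v1 + complex_of_real (p * (p - 1)) * v))) (at 1)"
  proof -
    note z = zero_less_one[where 'a = real]
    from has_vector_derivative_mult_right[OF has_vector_derivative_add[OF
          has_vector_derivative_mult[OF pow[OF z, of 1 p] wave_amp_has_vector_derivative[OF z, of 1 y]]
          has_vector_derivative_mult[OF pow[OF z, of p "p - 1"] wave_amp_has_vector_derivative[OF z, of 0 y]]], of \<kappa>]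
    show ?thesis by (simp add: u1_def[abs_def] v_def v1_def v2_def numeral_2_eq_2)
  qed
  have u: "u 1 = \<kappa> * v" "u1 1 = \<kappa> * (v1 + complex_of_real p * v)"
    by (simp_all add: u_def u1_def packet_def v_def v1_def)
  have Fu: "F y t = ln ((cmod (u t))\<^sup>2)" if "t \<in> {0<..}" for t
    using that by (simp add: F u_def)
  have ne: "u 1 \<noteq> 0" using u v \<open>\<kappa> \<noteq> 0\<close> by simp
  have q1: "u1 1 / u 1 = complex_of_real p + v1 / v"
    unfolding u using v \<open>\<kappa> \<noteq> 0\<close> by (simp add: field_simps)
  have q2: "\<kappa> * (v2 + complex_of_real p * v1 + (complex_of_real p * v1 + complex_of_real (p * (p - 1)) * v)) / u 1
      = complex_of_real (p * (p - 1)) + 2 * complex_of_real p * (v1 / v) + v2 / v"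
    unfolding u using v \<open>\<kappa> \<noteq> 0\<close> by (simp add: field_simps)
  have 1: "(1::real) \<in> {0<..}" by simp
  note deriv_ln_cmod2[OF open_greaterThan 1 d1 d2 ne Fu, unfolded q1]
    deriv2_ln_cmod2[OF open_greaterThan 1 d1 d2 ne Fu, unfolded q1 q2]
  ultimately show ?thesis
    unfolding hyp_laplacian_def by simp
qed

text \<open>Near a zero of the packet at which only the gradient in \<open>y\<close> survives and is a complex multiple
  of a real vector, the term \<open>- (\<nabla>u / u)\<^sup>2\<close> of \<open>\<Delta> log u\<close> dominates.\<close>

lemma hyp_laplacian_ln_packet_neg:
  fixes e :: "real^'n"
  assumes zero: "wave (amp 0 1) 0 = 0" "wave (amp 1 1) 0 = 0"
    and \<mu>: "(LINT \<xi>|lebesgue. complex_of_real (e \<bullet> \<xi>) * amp 0 1 \<xi>) \<noteq> 0"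
    and F: "\<And>y t. t > 0 \<Longrightarrow> F y t = ln ((cmod (packet \<kappa> p y t))\<^sup>2)" and "\<kappa> \<noteq> 0"
  shows "\<exists>y. packet \<kappa> p y 1 \<noteq> 0 \<and> hyp_laplacian F y 1 < 0"
proof -
  define m where "m b = (LINT \<xi>|lebesgue. (b \<bullet> \<xi>) * (\<phi> \<xi> * norm \<xi> powr \<beta> * bessel_moment \<nu> 0 (norm \<xi>)))" for b
  have amp0: "amp 0 1 \<xi> = complex_of_real (\<phi> \<xi> * norm \<xi> powr \<beta> * bessel_moment \<nu> 0 (norm \<xi>))" for \<xi>
    by (simp add: amp_def)
  have m: "(LINT \<xi>|lebesgue. complex_of_real (b \<bullet> \<xi>) * amp 0 1 \<xi>) = complex_of_real (m b)" for b
    unfolding amp0 of_real_mult[symmetric] m_def by (rule integral_complex_of_real)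
  have wave_m: "wave (deriv_symbol b (amp 0 1)) 0 = \<i> * complex_of_real (m b)" for b
    unfolding wave_def m[symmetric] by (simp add: mult.assoc)
  have "m e \<noteq> 0" using \<mu> unfolding m by simp
  note i0 = integrable_amp[of 1, OF zero_less_one]
  have supp1: "deriv_symbol b (amp 0 1) \<xi> \<noteq> 0 \<Longrightarrow> norm \<xi> \<le> R" for \<xi> b
    using amp_supp[of 0 1 \<xi>] by auto
  have supp2: "deriv_symbol b (deriv_symbol b (amp 0 1)) \<xi> \<noteq> 0 \<Longrightarrow> norm \<xi> \<le> R" for \<xi> b
    using amp_supp[of 0 1 \<xi>] by auto
  have i1: "integrable lebesgue (deriv_symbol b (amp 0 1))" for b
    by (rule integrable_deriv_symbol[OF i0 amp_supp])
  have i2: "integrable lebesgue (deriv_symbol b (deriv_symbol b (amp 0 1)))" for b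
    by (rule integrable_deriv_symbol[OF i1 supp1])
  have lim: "((\<lambda>s. wave q (s *\<^sub>R e)) \<longlongrightarrow> wave q 0) (at_right 0)"
    if "integrable lebesgue q" "\<And>\<xi>. q \<xi> \<noteq> 0 \<Longrightarrow> norm \<xi> \<le> R" for q
  proof -
    have "isCont (\<lambda>s. wave q (0 + s *\<^sub>R e)) 0"
      by (rule has_vector_derivative_continuous[OF wave_has_vector_derivative[OF that]])
    then have "((\<lambda>s. wave q (s *\<^sub>R e)) \<longlongrightarrow> wave q 0) (at 0)"
      by (simp add: isCont_def)
    then show ?thesis by (rule tendsto_mono[OF at_le[OF subset_UNIV]])
  qed
  have lima: "((\<lambda>s. wave (amp k 1) (s *\<^sub>R e)) \<longlongrightarrow> wave (amp k 1) 0) (at_right 0)" for k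
    by (rule lim[OF i0 amp_supp])
  define v where "v s = wave (amp 0 1) (s *\<^sub>R e)" for s
  \<comment> \<open>The quotient 1 / v diverges as s tends to 0, but s / v has the finite nonzero
    limit 1 / (i m(e)). All terms below are expressed through it.\<close>
  define r where "r s = complex_of_real s / v s" for s
  have "(v has_vector_derivative wave (deriv_symbol e (amp 0 1)) 0) (at 0)"
    unfolding v_def[abs_def]
    using wave_has_vector_derivative[OF i0[of 0] amp_supp[of 0 1], where y = 0 and b = e and t = 0] by simp
  then have "((\<lambda>s. (v s - v 0) /\<^sub>R (s - 0)) \<longlongrightarrow> wave (deriv_symbol e (amp 0 1)) 0) (at 0)"
    unfolding has_vector_derivative_iff_quotient .
  then have "((\<lambda>s. v s /\<^sub>R s) \<longlongrightarrow> \<i> * complex_of_real (m e)) (at 0)"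
    using zero(1) by (simp add: v_def wave_m)
  then have "((\<lambda>s. v s /\<^sub>R s) \<longlongrightarrow> \<i> * complex_of_real (m e)) (at_right 0)"
    by (rule tendsto_mono[OF at_le[OF subset_UNIV]])
  from tendsto_inverse[OF this] \<open>m e \<noteq> 0\<close>
  have r: "(r \<longlongrightarrow> inverse (\<i> * complex_of_real (m e))) (at_right 0)"
    by (simp add: r_def[abs_def] scaleR_conv_of_real divide_inverse mult.commute)
  have v_ne: "\<forall>\<^sub>F s in at_right 0. v s \<noteq> 0"
  proof -
    \<comment> \<open>Division by 0 yields 0, so \<open>r s \<noteq> 0\<close> already implies
      \<open>v s \<noteq> 0\<close>.\<close>
    have "\<forall>\<^sub>F s in at_right 0. r s \<noteq> 0"
      by (rule tendsto_imp_eventually_ne[OF r]) (use \<open>m e \<noteq> 0\<close> in simp)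
    then show ?thesis by (rule eventually_mono) (auto simp: r_def)
  qed
  have s: "((\<lambda>s. complex_of_real s) \<longlongrightarrow> 0) (at_right 0)"
    using tendsto_of_real[OF tendsto_ident_at[of "0::real" "{0<..}"], where 'a = complex] by simp
  let ?ax = "\<lambda>i. axis i 1 :: real^'n"
  \<comment> \<open>\<open>A\<close>, \<open>T\<close> and \<open>L\<close> are s^2 times the
    tangential terms, the second-order \<open>t\<close>-term and the whole hyperbolic Laplacian at
    (s e, 1). Each 1 / v takes up one factor s; the factors left over make everything vanish in the
    limit except the squares of the tangential derivatives.\<close>
  define A where "A i s = complex_of_real s * (wave (deriv_symbol (?ax i) (deriv_symbol (?ax i) (amp 0 1))) (s *\<^sub>R e) * r s)
      - (wave (deriv_symbol (?ax i) (amp 0 1)) (s *\<^sub>R e) * r s)\<^sup>2" for i s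
  define x where "x s = wave (amp 1 1) (s *\<^sub>R e) * r s" for s
  define T where "T s = (complex_of_real s)\<^sup>2 * complex_of_real (p * (p - 1)) + 2 * complex_of_real p * (complex_of_real s * x s)
     + complex_of_real s * (wave (amp 2 1) (s *\<^sub>R e) * r s) - (complex_of_real s * complex_of_real p + x s)\<^sup>2" for s
  define L where "L s = (\<Sum>i\<in>UNIV. 2 * Re (A i s)) + 2 * Re (T s)
      - (real CARD('n) - 1) * (2 * Re (complex_of_real s * (complex_of_real s * complex_of_real p + x s)))" for s
  have xlim: "(x \<longlongrightarrow> 0) (at_right 0)"
    using tendsto_mult[OF lima[of 1] r] unfolding x_def[abs_def] zero(2) by simp
  have Alim: "(A i \<longlongrightarrow> 0 * (wave (deriv_symbol (?ax i) (deriv_symbol (?ax i) (amp 0 1))) 0 * inverse (\<i> * complex_of_real (m e)))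
      - (wave (deriv_symbol (?ax i) (amp 0 1)) 0 * inverse (\<i> * complex_of_real (m e)))\<^sup>2) (at_right 0)" for i
    unfolding A_def[abs_def]
    by (intro tendsto_diff tendsto_mult tendsto_power s r lim[OF i2 supp2] lim[OF i1 supp1])
  \<comment> \<open>The factor i cancels in the quotient of gradient components, leaving minus the
    square of a real number.\<close>
  have Aval: "0 * (wave (deriv_symbol (?ax i) (deriv_symbol (?ax i) (amp 0 1))) 0 * inverse (\<i> * complex_of_real (m e)))
      - (wave (deriv_symbol (?ax i) (amp 0 1)) 0 * inverse (\<i> * complex_of_real (m e)))\<^sup>2 = complex_of_real (- (m (?ax i) / m e)\<^sup>2)" for i
    unfolding wave_m by (simp add: field_simps)
  have Tlim: "(T \<longlongrightarrow> 0\<^sup>2 * complex_of_real (p * (p - 1)) + 2 * complex_of_real p * (0 * 0)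
     + 0 * (wave (amp 2 1) 0 * inverse (\<i> * complex_of_real (m e))) - (0 * complex_of_real p + 0)\<^sup>2) (at_right 0)"
    unfolding T_def[abs_def]
    by (intro tendsto_diff tendsto_add tendsto_mult tendsto_power tendsto_const s r xlim lima)
  have "(L \<longlongrightarrow> (\<Sum>i\<in>UNIV. 2 * Re (complex_of_real (- (m (?ax i) / m e)\<^sup>2))) + 2 * Re 0
      - (real CARD('n) - 1) * (2 * Re (0 * (0 * complex_of_real p + 0)))) (at_right 0)"
    unfolding L_def[abs_def]
    by (intro tendsto_diff tendsto_add tendsto_sum tendsto_mult tendsto_const tendsto_Re s xlim
        Alim[unfolded Aval] Tlim[simplified])
  then have Llim: "(L \<longlongrightarrow> - (2 * (\<Sum>i\<in>UNIV. (m (?ax i) / m e)\<^sup>2))) (at_right 0)"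
    by (simp add: sum_negf sum_distrib_left)
  have "(\<Sum>i\<in>UNIV. (m (?ax i) / m e)\<^sup>2) > 0"
  proof -
    \<comment> \<open>\<open>m\<close> is linear, so \<open>m e\<close> is a combination of its
      values on the axes and these cannot all vanish.\<close>
    have "\<exists>i. m (?ax i) \<noteq> 0"
    proof (rule ccontr)
      assume "\<not> (\<exists>i. m (?ax i) \<noteq> 0)"
      then have z: "m (?ax i) = 0" for i by simp
      have int: "integrable lebesgue (\<lambda>\<xi>. complex_of_real (?ax i \<bullet> \<xi>) * amp 0 1 \<xi>)" for i
        using integrable_mult_right[OF i1[of "?ax i"], of "- \<i>"] by (simp add: mult.assoc[symmetric])
      have "complex_of_real (e \<bullet> \<xi>) * amp 0 1 \<xi> = (\<Sum>i\<in>UNIV. complex_of_real (e $ i) * (complex_of_real (?ax i \<bullet> \<xi>) * amp 0 1 \<xi>))" for \<xi>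
        by (simp add: inner_vec_def[of e \<xi>] inner_axis' sum_distrib_right mult.assoc)
      then have "complex_of_real (m e) = (\<Sum>i\<in>UNIV. complex_of_real (e $ i) * complex_of_real (m (?ax i)))"
        unfolding m[symmetric] using int by simp
      then show False using z \<open>m e \<noteq> 0\<close> by simp
    qed
    then obtain i where "m (?ax i) \<noteq> 0" ..
    then have "0 < (m (?ax i) / m e)\<^sup>2" using \<open>m e \<noteq> 0\<close> by simp
    also have "\<dots> \<le> (\<Sum>i\<in>UNIV. (m (?ax i) / m e)\<^sup>2)" by (rule member_le_sum) auto
    finally show ?thesis .
  qed
  then have "\<forall>\<^sub>F s in at_right 0. L s < 0"
    by (intro order_tendstoD(2)[OF Llim]) simp
  moreover have "\<forall>\<^sub>F s::real in at_right 0. s > 0" by (simp add: eventually_at_right_less)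
  ultimately have "\<forall>\<^sub>F s in at_right 0. L s < 0 \<and> v s \<noteq> 0 \<and> s > 0"
    using v_ne by eventually_elim auto
  then obtain s where s: "L s < 0" "v s \<noteq> 0" "s > 0"
    using eventually_happens'[OF trivial_limit_at_right_real] by blast
  have r: "z * r s = complex_of_real s * (z / v s)" for z by (simp add: r_def)
  have Re_scale: "Re (complex_of_real c * z) = c * Re z" for c z by simp
  have Ai: "A i s = complex_of_real (s\<^sup>2) * (wave (deriv_symbol (?ax i) (deriv_symbol (?ax i) (amp 0 1))) (s *\<^sub>R e) / v s
        - (wave (deriv_symbol (?ax i) (amp 0 1)) (s *\<^sub>R e) / v s)\<^sup>2)" for i
    unfolding A_def r by (simp add: algebra_simps power2_eq_square)
  have Ts: "T s = complex_of_real (s\<^sup>2) * (complex_of_real (p * (p - 1)) + 2 * complex_of_real p * (wave (amp 1 1) (s *\<^sub>R e) / v s)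
      + wave (amp 2 1) (s *\<^sub>R e) / v s - (complex_of_real p + wave (amp 1 1) (s *\<^sub>R e) / v s)\<^sup>2)"
    unfolding T_def x_def r by (simp add: algebra_simps power2_eq_square)
  have Xs: "complex_of_real s * (complex_of_real s * complex_of_real p + x s) =
      complex_of_real (s\<^sup>2) * (complex_of_real p + wave (amp 1 1) (s *\<^sub>R e) / v s)"
    unfolding x_def r by (simp add: algebra_simps power2_eq_square)
  have hyp: "hyp_laplacian F (s *\<^sub>R e) 1 =
    (\<Sum>i\<in>UNIV. 2 * Re (wave (deriv_symbol (?ax i) (deriv_symbol (?ax i) (amp 0 1))) (s *\<^sub>R e) / v s
        - (wave (deriv_symbol (?ax i) (amp 0 1)) (s *\<^sub>R e) / v s)\<^sup>2))
    + 2 * Re (complex_of_real (p * (p - 1)) + 2 * complex_of_real p * (wave (amp 1 1) (s *\<^sub>R e) / v s)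
        + wave (amp 2 1) (s *\<^sub>R e) / v s - (complex_of_real p + wave (amp 1 1) (s *\<^sub>R e) / v s)\<^sup>2)
    - (real CARD('n) - 1) * (2 * Re (complex_of_real p + wave (amp 1 1) (s *\<^sub>R e) / v s))"
    using s(2) unfolding v_def by (rule hyp_laplacian_ln_packet[OF F \<open>\<kappa> \<noteq> 0\<close>, rotated]) assumption
  have "L s = s\<^sup>2 * hyp_laplacian F (s *\<^sub>R e) 1"
    unfolding hyp L_def Ai Ts Xs Re_scale
    by (simp only: distrib_left right_diff_distrib sum_distrib_left mult.left_commute[of _ "s\<^sup>2"])
  then have "hyp_laplacian F (s *\<^sub>R e) 1 < 0"
    using s by (simp add: mult_less_0_iff)
  moreover have "packet \<kappa> p (s *\<^sub>R e) 1 \<noteq> 0"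
    using s(2) \<open>\<kappa> \<noteq> 0\<close> by (simp add: packet_def v_def)
  ultimately show ?thesis by blast
qed

end

section \<open>The weighted wavelet transform as a packet, and the choice of
  \<open>f\<close>\<close>

text \<open>Four powers of \<open>t\<close> meet: t^(-\<beta>) from the weight, t^(-n/2) from the
  normalization, t^n from the dilated window and t^\<beta> from |t \<xi>|^\<beta>. As \<beta> is the
  exponent in the window, t^(n/2) remains. The constant \<open>c\<close> appears conjugated because
  the window does.\<close>

lemma wavelet_transform_eq_packet:
  fixes \<phi> :: "real^'n \<Rightarrow> real" and \<psi> :: "real^'n \<Rightarrow> real" and c A :: complex
  assumes "bessel_packet \<phi> a R \<beta>" and \<beta>_eq: "\<beta> = real CARD('n) / 2 - \<alpha>"
    and g2: "integrable lebesgue (\<lambda>\<xi>. (cmod (complex_of_real (\<phi> \<xi>)))\<^sup>2)"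
    and f2: "L2_function (fourier_inverse (\<lambda>\<xi>. complex_of_real (\<phi> \<xi>)))"
    and \<psi>: "is_fourier_L2 (\<lambda>x. cnj (complex_of_real (\<psi> x)))
           (\<lambda>\<xi>. c * complex_of_real
              (norm \<xi> powr ((real CARD('n) - 2 * \<alpha>) / 2) * bessel_K (real CARD('n) / 2) (norm \<xi>)))"
    and "t > 0"
  shows "complex_of_real (t powr - \<beta>) *
      wavelet_transform A (\<lambda>x. complex_of_real (\<psi> x)) (fourier_inverse (\<lambda>\<xi>. complex_of_real (\<phi> \<xi>))) y t
    = bessel_packet.packet \<phi> \<beta> (real CARD('n) / 2) (A * cnj c) (real CARD('n) / 2) y t"
proof -
  interpret bessel_packet \<phi> a R \<beta> "real CARD('n) / 2" by fact
  let ?n = "real CARD('n)"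
  have \<beta>': "(?n - 2 * \<alpha>) / 2 = \<beta>" using \<beta>_eq by simp
  have kern: "complex_of_real (\<phi> \<xi>) * iexp (y \<bullet> \<xi>) * cnj (c * complex_of_real
              (norm (t *\<^sub>R \<xi>) powr ((?n - 2 * \<alpha>) / 2) * bessel_K (?n / 2) (norm (t *\<^sub>R \<xi>))))
     = (cnj c * complex_of_real (t powr \<beta>)) * (amp 0 t \<xi> * iexp (y \<bullet> \<xi>))" for \<xi>
    unfolding \<beta>' amp_def bessel_K_eq_moment using \<open>t > 0\<close> by (simp add: powr_mult mult_ac)
  have I: "(LINT x|lebesgue. fourier_inverse (\<lambda>\<xi>. complex_of_real (\<phi> \<xi>)) x * cnj (complex_of_real (\<psi> ((x - y) /\<^sub>R t))))
      = complex_of_real (t ^ CARD('n)) * ((cnj c * complex_of_real (t powr \<beta>)) * wave (amp 0 t) y)"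
    using wavelet_inner_product[OF \<phi>_int g2 f2 \<psi> \<open>t > 0\<close>, of y]
    unfolding kern wave_def integral_mult_right_zero by simp
  have "t powr - \<beta> * (t powr (- ?n / 2) * (t ^ CARD('n) * t powr \<beta>)) = t powr (?n / 2)"
  proof -
    have "t powr - \<beta> * (t powr (- ?n / 2) * (t powr ?n * t powr \<beta>)) = t powr (?n / 2)"
      unfolding powr_add[symmetric] by simp
    then show ?thesis using \<open>t > 0\<close> by (simp add: powr_realpow)
  qed
  then have P: "complex_of_real (t powr - \<beta>) * (complex_of_real (t powr (- ?n / 2)) * (complex_of_real (t ^ CARD('n)) * complex_of_real (t powr \<beta>)))
      = complex_of_real (t powr (?n / 2))"
    by (simp only: of_real_mult[symmetric])
  show ?thesis
    unfolding wavelet_transform_def packet_def I P[symmetric] by (simp only: mult_ac)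
qed

theorem theorem4p2:
  fixes \<psi> :: "real^'n \<Rightarrow> real" and w :: "real \<Rightarrow> real" and C :: "(real^'n) set"
    and \<alpha> \<beta> :: real and c C\<psi> :: complex
  assumes "CARD('n) > 1"
    and "\<alpha> < 0"
    and "\<And>x x'. norm x = norm x' \<Longrightarrow> \<psi> x = \<psi> x'"
    and "c \<noteq> 0"
    and "is_fourier_L2 (\<lambda>x. cnj (complex_of_real (\<psi> x)))
           (\<lambda>\<xi>. c * complex_of_real
              (norm \<xi> powr ((real CARD('n) - 2 * \<alpha>) / 2) * bessel_K (real CARD('n) / 2) (norm \<xi>)))"
    and "C\<psi> \<noteq> 0"
    and "\<beta> = real CARD('n) / 2 - \<alpha>"
    and "\<And>t. t > 0 \<Longrightarrow> w t = t powr (- \<beta>)"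
    and "\<And>x r. x \<in> C \<Longrightarrow> r > 0 \<Longrightarrow> r *\<^sub>R x \<in> C"
    and "0 \<in> C"
    and "interior C \<noteq> {}"
  shows "\<exists>f g. L2_function f \<and> is_fourier_L2 f g \<and>
           compact (closure {\<xi>. g \<xi> \<noteq> 0}) \<and> closure {\<xi>. g \<xi> \<noteq> 0} \<subseteq> C \<and>
           (\<exists>y t. t > 0 \<and>
              wavelet_transform C\<psi> (\<lambda>x. complex_of_real (\<psi> x)) f y t \<noteq> 0 \<and>
              hyp_laplacian
                (\<lambda>y t. ln ((cmod (complex_of_real (w t) *
                   wavelet_transform C\<psi> (\<lambda>x. complex_of_real (\<psi> x)) f y t))\<^sup>2)) y t < 0)"
proof -
  obtain p where p: "p \<in> interior C" "p \<noteq> 0"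
  proof -
    \<comment> \<open>A nonempty open set cannot be contained in the singleton {0}.\<close>
    have "interior C - {0} \<noteq> {}"
      using assms(11) not_open_singleton[of "0 :: real^'n"] open_interior[of C] by (metis Diff_eq_empty_iff subset_singletonD)
    then show ?thesis using that by blast
  qed
  have "2 \<le> DIM(real^'n)" using assms(1) by simp
  then obtain e' where e': "e' \<noteq> 0" "orthogonal p e'" by (rule orthogonal_to_vector_exists)
  define e where "e = e' /\<^sub>R norm e'"
  have e: "norm e = 1" "p \<bullet> e = 0" using e' by (auto simp: e_def orthogonal_def)
  obtain \<epsilon>0 where \<epsilon>0: "\<epsilon>0 > 0" "cball p \<epsilon>0 \<subseteq> interior C"
    using p(1) open_contains_cball[of "interior C"] by auto
  \<comment> \<open>Half the norm of \<open>p\<close> keeps the closed ball away from 0, which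
    provides the lower bound |p| - \<epsilon> for the packet.\<close>
  define \<epsilon> where "\<epsilon> = min \<epsilon>0 (norm p / 2)"
  have \<epsilon>: "\<epsilon> > 0" "cball p \<epsilon> \<subseteq> C" "\<epsilon> < norm p"
    using \<epsilon>0 p(2) interior_subset[of C] by (auto simp: \<epsilon>_def min_less_iff_disj)
  \<comment> \<open>The linear factor makes the function odd under the reflection; the tent,
    invariant because \<open>e\<close> is orthogonal to \<open>p\<close>, localizes it in the
    cone.\<close>
  define \<phi> where "\<phi> \<xi> = (\<xi> \<bullet> e) * max 0 (\<epsilon> - norm (\<xi> - p))" for \<xi>
  let ?g = "\<lambda>\<xi>. complex_of_real (\<phi> \<xi>)"
  have cont: "continuous_on UNIV \<phi>" unfolding \<phi>_def by (intro continuous_intros)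
  have contg: "continuous_on UNIV ?g" by (intro continuous_intros cont)
  have ball: "\<xi> \<in> ball p \<epsilon>" if "\<phi> \<xi> \<noteq> 0" for \<xi>
    using that by (auto simp: \<phi>_def dist_norm norm_minus_commute max_def split: if_splits)
  have low: "norm p - \<epsilon> \<le> norm \<xi>" and up: "norm \<xi> \<le> norm p + \<epsilon>" if "\<phi> \<xi> \<noteq> 0" for \<xi>
    using ball[OF that] norm_triangle_ineq2[of p \<xi>] norm_triangle_ineq2[of \<xi> p]
    by (auto simp: dist_norm norm_minus_commute)
  note plancherel = is_fourier_L2_inverse[OF contg, of "norm p + \<epsilon>"]
  have g: "integrable lebesgue ?g" "integrable lebesgue (\<lambda>\<xi>. (cmod (?g \<xi>))\<^sup>2)" "is_fourier_L2 (fourier_inverse ?g) ?g"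
    using plancherel up by auto
  have f2: "L2_function (fourier_inverse ?g)" using g(3) by (simp add: is_fourier_L2_def)
  let ?\<nu> = "real CARD('n) / 2"
  have bp: "bessel_packet \<phi> (norm p - \<epsilon>) (norm p + \<epsilon>) \<beta>"
    by unfold_locales (use cont g(1) \<epsilon> low up assms(2,7) in \<open>auto intro: borel_measurable_continuous_onI\<close>)
  interpret bessel_packet \<phi> "norm p - \<epsilon>" "norm p + \<epsilon>" \<beta> ?\<nu> by (rule bp)
  let ?W = "\<lambda>y t. wavelet_transform C\<psi> (\<lambda>x. complex_of_real (\<psi> x)) (fourier_inverse ?g) y t"
  let ?\<kappa> = "C\<psi> * cnj c"
  have W: "complex_of_real (w t) * ?W y t = packet ?\<kappa> ?\<nu> y t" if "t > 0" for y t
    unfolding assms(8)[OF that] by (rule wavelet_transform_eq_packet[OF bp assms(7) g(2) f2 assms(5) that])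
  let ?\<sigma> = "\<lambda>x. x - (2 * (x \<bullet> e)) *\<^sub>R e"
  have \<phi>_odd: "\<phi> (?\<sigma> \<xi>) = - \<phi> \<xi>" for \<xi>
  proof -
    have "(\<xi> - p) \<bullet> e = \<xi> \<bullet> e" using e(2) by (simp add: inner_diff_left)
    then have "norm (?\<sigma> \<xi> - p) = norm (?\<sigma> (\<xi> - p))" by (simp add: diff_diff_eq add.commute)
    then have "norm (?\<sigma> \<xi> - p) = norm (\<xi> - p)" by (simp only: norm_reflection[OF e(1)])
    then show ?thesis unfolding \<phi>_def reflection_inner[OF e(1)] by simp
  qed
  \<comment> \<open>Apart from \<open>\<phi>\<close> all factors of the amplitude depend only on
    |\<xi>|, so every \<open>amp m 1\<close> is odd. The cases m = 0 and m = 1 give the two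
    vanishing conditions.\<close>
  have zero: "wave (amp m 1) 0 = 0" for m
  proof -
    have "(LINT \<xi>|lebesgue. amp m 1 \<xi>) = 0"
    proof (rule integral_odd_eq_0[OF linear_reflection[of e] reflection_reflection[OF e(1)] norm_reflection[OF e(1)]])
      show "amp m 1 (?\<sigma> \<xi>) = - amp m 1 \<xi>" for \<xi>
        unfolding amp_def \<phi>_odd norm_reflection[OF e(1)] by simp
    qed measurable
    then show ?thesis by (simp add: wave_def)
  qed
  \<comment> \<open>The second factor \<open>e \<bullet> \<xi>\<close> turns the odd amplitude into
    a square times nonnegative factors. If its integral vanished, so would the integrand almost
    everywhere, although it is positive on an open half of the ball.\<close>
  have \<mu>: "(LINT \<xi>|lebesgue. complex_of_real (e \<bullet> \<xi>) * amp 0 1 \<xi>) \<noteq> 0"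
  proof
    define h where "h \<xi> = (e \<bullet> \<xi>) * (\<phi> \<xi> * norm \<xi> powr \<beta> * bessel_moment ?\<nu> 0 (norm \<xi>))" for \<xi>
    assume *: "(LINT \<xi>|lebesgue. complex_of_real (e \<bullet> \<xi>) * amp 0 1 \<xi>) = 0"
    have eq: "complex_of_real (e \<bullet> \<xi>) * amp 0 1 \<xi> = complex_of_real (h \<xi>)" for \<xi>
      by (simp add: amp_def h_def)
    have "integrable lebesgue (\<lambda>\<xi>. complex_of_real (e \<bullet> \<xi>) * amp 0 1 \<xi>)"
      using integrable_mult_right[OF integrable_deriv_symbol[OF integrable_amp[of 1 0] amp_supp[of 0 1], where b = e], of "- \<i>"]
      by (simp add: mult.assoc[symmetric])
    then have int: "integrable lebesgue h"
      unfolding eq complex_of_real_integrable_eq .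
    have h: "h \<xi> = (\<xi> \<bullet> e)\<^sup>2 * (max 0 (\<epsilon> - norm (\<xi> - p)) * norm \<xi> powr \<beta> * bessel_moment ?\<nu> 0 (norm \<xi>))" for \<xi>
      by (simp add: h_def \<phi>_def power2_eq_square inner_commute mult_ac)
    have "(LINT \<xi>|lebesgue. h \<xi>) = 0" using * unfolding eq integral_complex_of_real by simp
    then have "AE \<xi> in lebesgue. h \<xi> = 0"
    proof (subst integral_nonneg_eq_0_iff_AE[OF int, symmetric])
      show "AE \<xi> in lebesgue. 0 \<le> h \<xi>" by (simp add: h bessel_moment_nonneg)
    qed
    then have "AE \<xi> in lebesgue. \<xi> \<notin> ball p \<epsilon> \<inter> {\<xi>. e \<bullet> \<xi> > 0}"
    proof (rule AE_mp, intro AE_I2 impI notI)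
      fix \<xi> assume 0: "h \<xi> = 0" and \<xi>: "\<xi> \<in> ball p \<epsilon> \<inter> {\<xi>. e \<bullet> \<xi> > 0}"
      then have "norm \<xi> > 0" by auto
      with \<xi> have "h \<xi> > 0"
        unfolding h by (intro mult_pos_pos bessel_moment_pos) (auto simp: dist_norm norm_minus_commute inner_commute)
      with 0 show False by simp
    qed
    then have "negligible (ball p \<epsilon> \<inter> {\<xi>. e \<bullet> \<xi> > 0})"
      by (simp add: negligible_iff_null_sets AE_iff_null_sets open_Int open_halfspace_gt)
    \<comment> \<open>Moving from the centre along \<open>e\<close> by half the radius gives a point
      of the open half-ball, which is therefore not negligible.\<close>
    moreover have "p + (\<epsilon> / 2) *\<^sub>R e \<in> ball p \<epsilon> \<inter> {\<xi>. e \<bullet> \<xi> > 0}"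
      using e \<epsilon>(1) power2_norm_eq_inner[of e] by (simp add: dist_norm inner_add_right inner_commute)
    ultimately show False
      using open_not_negligible[of "ball p \<epsilon> \<inter> {\<xi>. e \<bullet> \<xi> > 0}"] open_ball open_halfspace_gt by blast
  qed
  have "?\<kappa> \<noteq> 0" using assms(4,6) by simp
  from hyp_laplacian_ln_packet_neg[OF zero zero \<mu> _ this, of "\<lambda>y t. ln ((cmod (complex_of_real (w t) * ?W y t))\<^sup>2)" ?\<nu>]
  obtain y where y: "packet ?\<kappa> ?\<nu> y 1 \<noteq> 0" "hyp_laplacian (\<lambda>y t. ln ((cmod (complex_of_real (w t) * ?W y t))\<^sup>2)) y 1 < 0"
    using W by auto
  have "closure {\<xi>. ?g \<xi> \<noteq> 0} \<subseteq> cball p \<epsilon>"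
    by (rule closure_minimal) (use ball in \<open>auto simp: less_imp_le\<close>)
  then have "compact (closure {\<xi>. ?g \<xi> \<noteq> 0})" "closure {\<xi>. ?g \<xi> \<noteq> 0} \<subseteq> C"
    using \<epsilon>(2) compact_closure bounded_subset[OF bounded_cball closure_subset[THEN order_trans]] by auto
  moreover have "?W y 1 \<noteq> 0" using W[of 1 y] y(1) by auto
  ultimately show ?thesis
    using f2 g(3) y(2) zero_less_one[where 'a = real] by blast
qed

end
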